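(* Let $D$ be a compact subset of $\mathbb{R}^d$ with non-empty interior. Let $Y$ be a Gaussian process on $D$ with mean zero and covariance function $k$. Assume that $k$ is defined on $\mathbb{R}^d$, is continuous, and satisfies $k(x,y)>0$ for two distinct points $x,y$ in the interior of $D$. Assume also that $Y$ has the no-empty-ball (NEB) property. For each $p\ge 1$ let weight functions $\alpha_1,\dots,\alpha_p:[0,\infty)^{p+1}\to\mathbb{R}$ be given (they may depend on $p$). For any triangular array of observation points $(x_{ni})_{1\le i\le n;\,n\in\mathbb{N}}$ in $D$, and for each $n$, let $X$ be the $n\times d$ matrix with rows $x_{n1}^t,\dots,x_{nn}^t$, let $p_n$ be a number of Kriging predictors, let $X_1,\dots,X_{p_n}$ be a partition of (the rows of) $X$, and define $$M_{\mathcal{A},n}(x)=\sum_{k=1}^{p_n}\alpha_k\big(v_1(x),\dots,v_{p_n}(x),v_{prior}(x)\big)\,M_k(x),$$ with $M_k(x)$, $v_k(x)$ and $v_{prior}(x)$ as defined in the context. Assume that $$\alpha_{k}(v_1(x),\dots,v_{p_n}(x),v_{prior}(x)) \le \frac{a(v_k(x),v_{prior}(x))}{\sum_{l=1}^{p_n} b(v_l(x),v_{prior}(x))}$$ (whenever the right-hand side is well-defined), where $a$ and $b$ are given deterministic continuous functions from $\Delta=\{(s,t)\in(0,\infty)^2;\ s\le t\}$ to $[0,\infty)$ (not depending on $n$), with $a$ and $b$ positive on $\mathring\Delta=\{(s,t)\in(0,\infty)^2;\ s<t\}$. Then there exist a triangular array of observation points $(x_{ni})_{1\le i\le n;\,n\in\mathbb{N}}$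 in $D$ such that $\lim_{n\to\infty}\sup_{x\in D}\min_{i=1,\dots,n}\|x_{ni}-x\|=0$, and a triangular array of submatrices $X_1,\dots,X_{p_n}$ forming a partition of $X$, with $p_n\to\infty$ and $p_n/n\to 0$ as $n\to\infty$, such that $$\liminf_{n\to\infty}\int_D \mathrm{E}\big[(Y(x)-M_{\mathcal{A},n}(x))^2\big]\,dx>0.$$ As a consequence, there exists a subset $C$ of $D$ with strictly positive Lebesgue measure such that, for all $x_0\in C$, $\mathrm{E}\big[(Y(x_0)-M_{\mathcal{A},n}(x_0))^2\big]$ does not converge to $0$ as $n\to\infty$.
   Context: Notation: for matrices $A,B$ whose rows are points $a_i^t$, $b_j^t$ of $D$, $k(A,B)$ is the matrix with entries $k(a_i,b_j)$, and $Y(A)$ is the column vector with entries $Y(a_i)$. A partition $X_1,\dots,X_p$ of $X$ consists of non-empty submatrices made of rows of $X$, each row of $X$ belonging to exactly one $X_i$. For each $i$, $M_i(x)=k(x,X_i)k(X_i,X_i)^{-1}Y(X_i)$ and $v_i(x)=k(x,x)-k(x,X_i)k(X_i,X_i)^{-1}k(X_i,x)$ are the conditional mean and variance of $Y(x)$ given $Y(X_i)$; $v_{prior}(x)=k(x,x)$. NEB property: a Gaussian process $Y$ on $D$ has the NEB property if for any $x_0\in D$ and any sequence $(x_i)_{i\ge1}$ of points in $D$, the following two assertions are equivalent: (1) $\mathrm{Var}[Y(x_0)\mid Y(x_1),\dots,Y(x_n)]\to0$ as $n\to\infty$; (2) $x_0$ is an adherent point of the sequence $(x_i)_{i\ge1}$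 (i.e. $x_0$ belongs to the closure of $\{x_i;\ i\ge 1\}$). *)

theory Defs
  imports "HOL-Probability.Probability" "Jordan_Normal_Form.Gauss_Jordan_Elimination"
begin

section \<open>Gaussian processes\<close>

text \<open>Constants count as (degenerate) Gaussian variables.\<close>

definition gaussian_rv :: "'w measure \<Rightarrow> ('w \<Rightarrow> real) \<Rightarrow> bool" where
  "gaussian_rv M Z \<longleftrightarrow>
     Z \<in> borel_measurable M \<and>
     ((\<exists>c. AE \<omega> in M. Z \<omega> = c) \<or>
      (\<exists>\<mu> \<sigma>. 0 < \<sigma> \<and> distributed M lborel Z (normal_density \<mu> \<sigma>)))"

definition gaussian_process :: "'w measure \<Rightarrow> 'i set \<Rightarrow> ('i \<Rightarrow> 'w \<Rightarrow> real) \<Rightarrow> bool" where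
  "gaussian_process M D Y \<longleftrightarrow>
     prob_space M \<and>
     (\<forall>S c. finite S \<and> S \<subseteq> D \<longrightarrow> gaussian_rv M (\<lambda>\<omega>. \<Sum>s\<in>S. c s * Y s \<omega>))"

definition has_mean_zero :: "'w measure \<Rightarrow> 'i set \<Rightarrow> ('i \<Rightarrow> 'w \<Rightarrow> real) \<Rightarrow> bool" where
  "has_mean_zero M D Y \<longleftrightarrow> (\<forall>x\<in>D. prob_space.expectation M (Y x) = 0)"

definition has_covariance ::
  "'w measure \<Rightarrow> 'i set \<Rightarrow> ('i \<Rightarrow> 'w \<Rightarrow> real) \<Rightarrow> ('i \<Rightarrow> 'i \<Rightarrow> real) \<Rightarrow> bool" where
  "has_covariance M D Y k \<longleftrightarrow>
     (\<forall>x\<in>D. \<forall>y\<in>D.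
        prob_space.expectation M (\<lambda>\<omega>. (Y x \<omega> - prob_space.expectation M (Y x)) *
                                        (Y y \<omega> - prob_space.expectation M (Y y))) = k x y)"

section \<open>Conditional variance and the no-empty-ball property\<close>

text \<open>The \<sigma>-algebra on the sample space generated by the random vector \<open>(Z i)\<close>, \<open>i \<in> I\<close>.\<close>

definition generated_by :: "'w measure \<Rightarrow> 'j set \<Rightarrow> ('j \<Rightarrow> 'w \<Rightarrow> real) \<Rightarrow> 'w measure" where
  "generated_by M I Z =
     vimage_algebra (space M) (\<lambda>\<omega>. \<lambda>i\<in>I. Z i \<omega>) (Pi\<^sub>M I (\<lambda>_. borel))"

definition cond_var :: "'w measure \<Rightarrow> 'w measure \<Rightarrow> ('w \<Rightarrow> real) \<Rightarrow> 'w \<Rightarrow> real" where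
  "cond_var M F Z = real_cond_exp M F (\<lambda>\<omega>. (Z \<omega> - real_cond_exp M F Z \<omega>)\<^sup>2)"

text \<open>The conditional variance is a random variable; for a Gaussian process it is almost surely
  constant, so convergence of the numbers is almost sure convergence. Conditioning through
  \<open>generated_by\<close> makes sense also when points of the sequence are repeated, where a formula with an
  inverse covariance matrix would not.\<close>

definition neb_property ::
  "'w measure \<Rightarrow> 'a::topological_space set \<Rightarrow> ('a \<Rightarrow> 'w \<Rightarrow> real) \<Rightarrow> bool" where
  "neb_property M D Y \<longleftrightarrow>
     (\<forall>x0\<in>D. \<forall>x :: nat \<Rightarrow> 'a. (\<forall>i\<ge>1. x i \<in> D) \<longrightarrow>
        ((AE \<omega> in M. (\<lambda>n. cond_var M (generated_by M {1..n} (\<lambda>i. Y (x i))) (Y x0) \<omega>)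
                        \<longlonglongrightarrow> 0)
         \<longleftrightarrow> x0 \<in> closure (x ` {1..})))"

section \<open>Kriging predictors\<close>

text \<open>A matrix whose rows are points is represented by the list of its rows. \<open>Matrix.mat\<close> is
  qualified because HOL-Analysis has another constant of that name.\<close>

definition kmat :: "('a \<Rightarrow> 'a \<Rightarrow> real) \<Rightarrow> 'a list \<Rightarrow> 'a list \<Rightarrow> real mat" where
  "kmat k A B = Matrix.mat (length A) (length B) (\<lambda>(i, j). k (A ! i) (B ! j))"

definition obs_col :: "('a \<Rightarrow> real) \<Rightarrow> 'a list \<Rightarrow> real mat" where
  "obs_col y A = Matrix.mat (length A) 1 (\<lambda>(i, j). y (A ! i))"

text \<open>\<open>mat_inverse\<close> is option-valued; the two definitions below are meaningful only if
  \<open>invertible_mat (kmat k A A)\<close>. The products are \<open>1 \<times> 1\<close> matrices, read as scalars.\<close>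

definition krig_mean ::
  "('a \<Rightarrow> 'a \<Rightarrow> real) \<Rightarrow> ('a \<Rightarrow> 'w \<Rightarrow> real) \<Rightarrow> 'a list \<Rightarrow> 'a \<Rightarrow> 'w \<Rightarrow> real" where
  "krig_mean k Y A x \<omega> =
     (kmat k [x] A * the (mat_inverse (kmat k A A)) * obs_col (\<lambda>z. Y z \<omega>) A) $$ (0, 0)"

definition krig_var :: "('a \<Rightarrow> 'a \<Rightarrow> real) \<Rightarrow> 'a list \<Rightarrow> 'a \<Rightarrow> real" where
  "krig_var k A x =
     k x x - (kmat k [x] A * the (mat_inverse (kmat k A A)) * kmat k A [x]) $$ (0, 0)"

definition prior_var :: "('a \<Rightarrow> 'a \<Rightarrow> real) \<Rightarrow> 'a \<Rightarrow> real" where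
  "prior_var k x = k x x"

section \<open>Partitions of the rows and aggregated predictors\<close>

text \<open>The rows of \<open>X\<close> are indexed by \<open>{1..n}\<close>; a partition of the rows into \<open>p\<close> submatrices is
  given by the sets \<open>I 1, \<dots>, I p\<close> of row indices.\<close>

definition row_partition :: "nat \<Rightarrow> nat \<Rightarrow> (nat \<Rightarrow> nat set) \<Rightarrow> bool" where
  "row_partition n p I \<longleftrightarrow>
     (\<forall>l\<in>{1..p}. I l \<noteq> {} \<and> I l \<subseteq> {1..n}) \<and>
     (\<forall>i\<in>{1..n}. \<exists>!l. l \<in> {1..p} \<and> i \<in> I l)"

definition submat :: "(nat \<Rightarrow> 'a) \<Rightarrow> nat set \<Rightarrow> 'a list" where
  "submat x J = map x (sorted_list_of_set J)"

definition well_posed ::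
  "('a \<Rightarrow> 'a \<Rightarrow> real) \<Rightarrow> (nat \<Rightarrow> 'a) \<Rightarrow> nat \<Rightarrow> (nat \<Rightarrow> nat set) \<Rightarrow> bool" where
  "well_posed k x p I \<longleftrightarrow>
     (\<forall>l\<in>{1..p}. invertible_mat (kmat k (submat x (I l)) (submat x (I l))))"

text \<open>The point \<open>(v\<^sub>1(z), \<dots>, v\<^sub>p(z), v\<^sub>p\<^sub>r\<^sub>i\<^sub>o\<^sub>r(z))\<close>, a list of length \<open>p + 1\<close>.\<close>

definition var_args ::
  "('a \<Rightarrow> 'a \<Rightarrow> real) \<Rightarrow> (nat \<Rightarrow> 'a) \<Rightarrow> nat \<Rightarrow> (nat \<Rightarrow> nat set) \<Rightarrow> 'a \<Rightarrow> real list" where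
  "var_args k x p I z =
     map (\<lambda>l. krig_var k (submat x (I l)) z) [1..<Suc p] @ [prior_var k z]"

text \<open>\<open>\<alpha> p j\<close> is the weight function of the \<open>j\<close>-th among \<open>p\<close> predictors.\<close>

definition aggregated ::
  "('a \<Rightarrow> 'a \<Rightarrow> real) \<Rightarrow> ('a \<Rightarrow> 'w \<Rightarrow> real) \<Rightarrow> (nat \<Rightarrow> nat \<Rightarrow> real list \<Rightarrow> real) \<Rightarrow>
   (nat \<Rightarrow> 'a) \<Rightarrow> nat \<Rightarrow> (nat \<Rightarrow> nat set) \<Rightarrow> 'a \<Rightarrow> 'w \<Rightarrow> real" where
  "aggregated k Y \<alpha> x p I z \<omega> =
     (\<Sum>j=1..p. \<alpha> p j (var_args k x p I z) * krig_mean k Y (submat x (I j)) z \<omega>)"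

definition mse ::
  "'w measure \<Rightarrow> ('a \<Rightarrow> 'a \<Rightarrow> real) \<Rightarrow> ('a \<Rightarrow> 'w \<Rightarrow> real) \<Rightarrow> (nat \<Rightarrow> nat \<Rightarrow> real list \<Rightarrow> real) \<Rightarrow>
   (nat \<Rightarrow> 'a) \<Rightarrow> nat \<Rightarrow> (nat \<Rightarrow> nat set) \<Rightarrow> 'a \<Rightarrow> real" where
  "mse M k Y \<alpha> x p I z =
     prob_space.expectation M (\<lambda>\<omega>. (Y z \<omega> - aggregated k Y \<alpha> x p I z \<omega>)\<^sup>2)"

section \<open>The upper bound on the weights\<close>

definition Delta :: "(real \<times> real) set" where
  "Delta = {(s, t). 0 < s \<and> 0 < t \<and> s \<le> t}"

definition Delta_int :: "(real \<times> real) set" where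
  "Delta_int = {(s, t). 0 < s \<and> 0 < t \<and> s < t}"

text \<open>The premises following \<open>z \<in> D\<close> say that the quotient is well-defined: the predictors exist,
  \<open>a\<close> and \<open>b\<close> are evaluated in their domain \<open>Delta\<close>, and the denominator does not vanish. The
  condition ranges over all designs, since \<open>\<alpha>\<close>, \<open>a\<close> and \<open>b\<close> are given before the design.\<close>

definition weights_bounded ::
  "'a set \<Rightarrow> ('a \<Rightarrow> 'a \<Rightarrow> real) \<Rightarrow> (nat \<Rightarrow> nat \<Rightarrow> real list \<Rightarrow> real) \<Rightarrow>
   (real \<times> real \<Rightarrow> real) \<Rightarrow> (real \<times> real \<Rightarrow> real) \<Rightarrow> bool" where
  "weights_bounded D k \<alpha> a b \<longleftrightarrow>
     (\<forall>n\<ge>1. \<forall>x p I. (\<forall>i\<in>{1..n}. x i \<in> D) \<and> row_partition n p I \<longrightarrow>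
       (\<forall>z\<in>D.
          let v = (\<lambda>l. krig_var k (submat x (I l)) z); vp = prior_var k z in
          well_posed k x p I \<and> (\<forall>l\<in>{1..p}. (v l, vp) \<in> Delta) \<and> (\<Sum>l=1..p. b (v l, vp)) \<noteq> 0
          \<longrightarrow> (\<forall>j\<in>{1..p}. \<alpha> p j (var_args k x p I z)
                             \<le> a (v j, vp) / (\<Sum>l=1..p. b (v l, vp)))))"

end

theory Submission
  imports Defs "Jordan_Normal_Form.Determinant" "HOL-Real_Asymp.Real_Asymp"
begin

text \<open>One block of the design consists of the first \<open>m\<close> points of a sequence dense in \<open>D\<close>, where \<open>m\<close>
  grows slowly with \<open>n\<close>; all other observations lie in a ball \<open>B\<close> away from the prediction point \<open>z\<close>
  but positively correlated with it, among them \<open>s\<close> one-point blocks, where \<open>m\<close> is chosen so slow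
  that \<open>s\<close> dominates the values of the function \<open>a\<close> at the variance of the first block. Each one-point
  block adds the same positive amount to the denominator of the weight bound, so that the weight \<open>w\<close> of
  the first block is at most \<open>1/2\<close>. As the first block predicts \<open>Y z\<close> almost exactly, the error is
  essentially \<open>(1 - w) Y z\<close> minus a linear combination of observations in \<open>B\<close>, and such combinations
  stay away from \<open>Y z\<close> by the NEB property. All of this is uniform for \<open>z\<close> in a compact set of positive
  measure that avoids the dense sequence. The bound on \<open>w\<close> is one-sided, which suffices because
  \<open>\<bar>w\<bar> \<le> 1 - w\<close>.

  The NEB property speaks of conditional variances. They equal the squared distance of \<open>Y z\<close> to the linear
  span of the observations, because the residual of the orthogonal projection is independent of them.\<close>

section \<open>Uniqueness for characteristic functions\<close>

text \<open>After normalisation the positive and negative parts of \<open>G\<close> are probability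
  densities with respect to \<open>M\<close>. The laws of \<open>U\<close> under these two measures
  have the same characteristic function, so they agree by Levy's uniqueness theorem.\<close>

lemma (in prob_space) char_zero_imp_indicator_zero_real:
  fixes G U :: "'a \<Rightarrow> real"
  assumes G: "integrable M G" and U[measurable]: "U \<in> borel_measurable M"
    and zero: "\<And>t. (CLINT \<omega>|M. complex_of_real (G \<omega>) * iexp (t * U \<omega>)) = 0"
    and A[measurable]: "A \<in> sets borel"
  shows "(LINT \<omega>|M. G \<omega> * indicator A (U \<omega>)) = 0"
proof -
  define Gp where "Gp = (\<lambda>\<omega>. max 0 (G \<omega>))"
  define Gm where "Gm = (\<lambda>\<omega>. max 0 (- G \<omega>))"
  have [measurable]: "G \<in> borel_measurable M" using G by auto
  have Gp: "integrable M Gp" "\<And>\<omega>. 0 \<le> Gp \<omega>" and Gm: "integrable M Gm" "\<And>\<omega>. 0 \<le> Gm \<omega>"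
    unfolding Gp_def Gm_def using G by auto
  have [measurable]: "Gp \<in> borel_measurable M" "Gm \<in> borel_measurable M"
    using Gp Gm by auto
  have diff: "G \<omega> = Gp \<omega> - Gm \<omega>" for \<omega> by (auto simp: Gp_def Gm_def)
  have int_ie: "integrable M (\<lambda>\<omega>. complex_of_real (H \<omega>) * iexp (t * U \<omega>))"
    if "integrable M H" for t and H :: "'a \<Rightarrow> real"
    by (rule Bochner_Integration.integrable_bound[OF that])
      (use that in \<open>auto simp: norm_mult\<close>)
  have eq: "(CLINT \<omega>|M. complex_of_real (Gp \<omega>) * iexp (t * U \<omega>)) =
            (CLINT \<omega>|M. complex_of_real (Gm \<omega>) * iexp (t * U \<omega>))" for t
  proof -
    have "0 = (CLINT \<omega>|M. complex_of_real (Gp \<omega>) * iexp (t * U \<omega>) - complex_of_real (Gm \<omega>) * iexp (t * U \<omega>))"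
      using zero[of t] by (simp add: diff algebra_simps)
    then show ?thesis using int_ie[OF Gp(1), of t] int_ie[OF Gm(1), of t] by simp
  qed
  define c where "c = (LINT \<omega>|M. Gp \<omega>)"
  \<comment> \<open>The case \<open>t = 0\<close> shows that both parts have the same total mass, so
    one constant normalises both.\<close>
  have cm: "(LINT \<omega>|M. Gm \<omega>) = c"
    using eq[of 0] unfolding c_def by (simp add: integral_complex_of_real)
  have c0: "0 \<le> c" unfolding c_def using Gp by simp
  have goal: "(LINT \<omega>|M. Gp \<omega> * indicator A (U \<omega>)) = (LINT \<omega>|M. Gm \<omega> * indicator A (U \<omega>))"
  proof (cases "c = 0")
    case True
    then have "AE \<omega> in M. Gp \<omega> = 0" "AE \<omega> in M. Gm \<omega> = 0"
      using integral_nonneg_eq_0_iff_AE[OF Gp(1)] integral_nonneg_eq_0_iff_AE[OF Gm(1)] Gp Gm cm c_def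
      by auto
    then have "AE \<omega> in M. Gp \<omega> * indicator A (U \<omega>) = Gm \<omega> * indicator A (U \<omega>)" by eventually_elim simp
    then show ?thesis by (intro integral_cong_AE) auto
  next
    case False
    then have c: "c > 0" using c0 by simp
    define N where "N H = distr (density M (\<lambda>\<omega>. ennreal (H \<omega> / c))) borel U" for H
    have rd: "real_distribution (N H)" if H: "integrable M H" "\<And>\<omega>. 0 \<le> H \<omega>" "(LINT \<omega>|M. H \<omega>) = c" for H
    proof -
      have [measurable]: "H \<in> borel_measurable M" using H by auto
      have "(\<integral>\<^sup>+\<omega>. ennreal (H \<omega> / c) \<partial>M) = ennreal (LINT \<omega>|M. H \<omega> / c)"
        by (rule nn_integral_eq_integral) (use H c in auto)
      also have "\<dots> = 1" using H c by simp
      finally have "prob_space (density M (\<lambda>\<omega>. ennreal (H \<omega> / c)))"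
        by (intro prob_spaceI) (simp add: emeasure_density)
      then interpret d: prob_space "density M (\<lambda>\<omega>. ennreal (H \<omega> / c))" .
      have "prob_space (N H)" unfolding N_def by (rule d.prob_space_distr) simp
      then show ?thesis unfolding N_def real_distribution_def real_distribution_axioms_def by simp
    qed
    have ch: "char (N H) t = (CLINT \<omega>|M. complex_of_real (H \<omega>) * iexp (t * U \<omega>)) / c"
      if H: "integrable M H" "\<And>\<omega>. 0 \<le> H \<omega>" for H t
    proof -
      have [measurable]: "H \<in> borel_measurable M" using H by auto
      have "char (N H) t = (CLINT \<omega>|M. (H \<omega> / c) *\<^sub>R iexp (t * U \<omega>))"
        unfolding char_def N_def
        by (subst integral_distr, simp, simp) (subst integral_density, use H c in auto)
      also have "\<dots> = (CLINT \<omega>|M. (complex_of_real (H \<omega>) * iexp (t * U \<omega>)) / c)"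
        by (intro Bochner_Integration.integral_cong) (auto simp: scaleR_conv_of_real)
      finally show ?thesis by simp
    qed
    have "N Gp = N Gm"
      by (rule Levy_uniqueness)
        (use rd Gp Gm cm c_def ch eq in \<open>auto simp: fun_eq_iff\<close>)
    have ms: "(LINT \<omega>|M. H \<omega> * indicator A (U \<omega>)) = c * measure (N H) A"
      if H: "integrable M H" "\<And>\<omega>. 0 \<le> H \<omega>" for H
    proof -
      have [measurable]: "H \<in> borel_measurable M" using H by auto
      have "measure (N H) A = (LINT x|N H. indicator A x)" by (simp add: N_def)
      also have "\<dots> = (LINT \<omega>|M. (H \<omega> / c) * indicator A (U \<omega>))"
        unfolding N_def by (subst integral_distr, simp, simp) (subst integral_density, use H c in auto)
      finally show ?thesis using c by simp
    qed
    show ?thesis using ms Gp Gm \<open>N Gp = N Gm\<close> by simp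
  qed
  have ia: "integrable M (\<lambda>\<omega>. H \<omega> * indicator A (U \<omega>))" if "integrable M H" for H :: "'a \<Rightarrow> real"
    by (rule Bochner_Integration.integrable_bound[OF that])
      (use that in \<open>auto simp: indicator_def\<close>)
  have "(LINT \<omega>|M. G \<omega> * indicator A (U \<omega>)) = (LINT \<omega>|M. Gp \<omega> * indicator A (U \<omega>) - Gm \<omega> * indicator A (U \<omega>))"
    by (simp add: diff algebra_simps)
  also have "\<dots> = 0" using ia[OF Gp(1)] ia[OF Gm(1)] goal by simp
  finally show ?thesis .
qed

text \<open>Conjugating the hypothesis at \<open>-t\<close> gives it for \<open>cnj G\<close>, hence
  for the real and imaginary parts. Complex weights arise in \<open>char_zero_imp_box_zero\<close>,
  where \<open>G\<close> gets multiplied by exponentials.\<close>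

lemma (in prob_space) char_zero_imp_indicator_zero:
  fixes G :: "'a \<Rightarrow> complex" and U :: "'a \<Rightarrow> real"
  assumes G: "integrable M G" and U[measurable]: "U \<in> borel_measurable M"
    and zero: "\<And>t. (CLINT \<omega>|M. G \<omega> * iexp (t * U \<omega>)) = 0"
    and A[measurable]: "A \<in> sets borel"
  shows "(CLINT \<omega>|M. G \<omega> * indicator A (U \<omega>)) = 0"
proof -
  have [measurable]: "G \<in> borel_measurable M" using G by auto
  have int: "integrable M (\<lambda>\<omega>. H \<omega> * iexp (t * U \<omega>))" if "integrable M H" for t and H :: "'a \<Rightarrow> complex"
    by (rule Bochner_Integration.integrable_bound[OF that])
      (use that in \<open>auto simp: norm_mult\<close>)
  have ci: "integrable M (\<lambda>\<omega>. cnj (G \<omega>))" using G by simp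
  have cz: "(CLINT \<omega>|M. cnj (G \<omega>) * iexp (t * U \<omega>)) = 0" for t
  proof -
    have "(CLINT \<omega>|M. cnj (G \<omega>) * iexp (t * U \<omega>)) = (CLINT \<omega>|M. cnj (G \<omega> * iexp (- t * U \<omega>)))"
      by (intro Bochner_Integration.integral_cong) (auto simp: exp_cnj)
    also have "\<dots> = 0" using zero[of "-t"] by (simp add: integral_cnj del: complex_cnj_mult)
    finally show ?thesis .
  qed
  have re: "(LINT \<omega>|M. Re (G \<omega>) * indicator A (U \<omega>)) = 0"
  proof (rule char_zero_imp_indicator_zero_real)
    fix t
    have "(CLINT \<omega>|M. complex_of_real (Re (G \<omega>)) * iexp (t * U \<omega>)) =
      (CLINT \<omega>|M. (G \<omega> * iexp (t * U \<omega>) + cnj (G \<omega>) * iexp (t * U \<omega>)) / 2)"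
      by (intro Bochner_Integration.integral_cong) (auto simp: complex_add_cnj simp flip: distrib_right)
    also have "\<dots> = 0" using int[OF G, of t] int[OF ci, of t] zero[of t] cz[of t] by simp
    finally show "(CLINT \<omega>|M. complex_of_real (Re (G \<omega>)) * iexp (t * U \<omega>)) = 0" .
  qed (use G in auto)
  have im: "(LINT \<omega>|M. Im (G \<omega>) * indicator A (U \<omega>)) = 0"
  proof (rule char_zero_imp_indicator_zero_real)
    fix t
    have Im_eq: "complex_of_real (Im z) = (z - cnj z) / (2 * \<i>)" for z
      by (simp add: complex_diff_cnj complex_eq_iff)
    have "(CLINT \<omega>|M. complex_of_real (Im (G \<omega>)) * iexp (t * U \<omega>)) =
      (CLINT \<omega>|M. (G \<omega> * iexp (t * U \<omega>) - cnj (G \<omega>) * iexp (t * U \<omega>)) / (2 * \<i>))"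
      by (intro Bochner_Integration.integral_cong) (auto simp: Im_eq left_diff_distrib)
    also have "\<dots> = 0" using int[OF G, of t] int[OF ci, of t] zero[of t] cz[of t] by simp
    finally show "(CLINT \<omega>|M. complex_of_real (Im (G \<omega>)) * iexp (t * U \<omega>)) = 0" .
  qed (use G in auto)
  have i: "integrable M (\<lambda>\<omega>. G \<omega> * indicator A (U \<omega>))"
    by (rule Bochner_Integration.integrable_bound[OF G])
      (auto simp: indicator_def)
  have "Re (CLINT \<omega>|M. G \<omega> * indicator A (U \<omega>)) = (LINT \<omega>|M. Re (G \<omega> * indicator A (U \<omega>)))"
    by (rule integral_Re[OF i, symmetric])
  also have "(\<lambda>\<omega>. Re (G \<omega> * indicator A (U \<omega>))) = (\<lambda>\<omega>. Re (G \<omega>) * indicator A (U \<omega>))"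
    by (auto simp: indicator_def)
  finally have "Re (CLINT \<omega>|M. G \<omega> * indicator A (U \<omega>)) = 0" using re by simp
  moreover have "Im (CLINT \<omega>|M. G \<omega> * indicator A (U \<omega>)) = (LINT \<omega>|M. Im (G \<omega> * indicator A (U \<omega>)))"
    by (rule integral_Im[OF i, symmetric])
  moreover have "(\<lambda>\<omega>. Im (G \<omega> * indicator A (U \<omega>))) = (\<lambda>\<omega>. Im (G \<omega>) * indicator A (U \<omega>))"
    by (auto simp: indicator_def)
  ultimately show ?thesis using im by (simp add: complex_eq_iff)
qed

text \<open>Exponentials are traded for indicators one coordinate at a time. An indicator already
  obtained is absorbed into the weight, which is why \<open>G\<close> is arbitrary in the
  induction.\<close>

lemma (in prob_space) char_zero_imp_box_zero:
  fixes G :: "'a \<Rightarrow> complex" and U :: "'i \<Rightarrow> 'a \<Rightarrow> real"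
  assumes "finite I" and "integrable M G" and "\<And>i. i \<in> I \<Longrightarrow> U i \<in> borel_measurable M"
    and "\<And>t. (CLINT \<omega>|M. G \<omega> * iexp (\<Sum>i\<in>I. t i * U i \<omega>)) = 0"
    and "\<And>i. i \<in> I \<Longrightarrow> A i \<in> sets borel"
  shows "(CLINT \<omega>|M. G \<omega> * (\<Prod>i\<in>I. indicator (A i) (U i \<omega>))) = 0"
  using assms
proof (induction I arbitrary: G rule: finite_induct)
  case empty
  then show ?case by simp
next
  case (insert j I)
  have [measurable]: "U j \<in> borel_measurable M" "A j \<in> sets borel" "G \<in> borel_measurable M"
    using insert.prems by auto
  have Um [measurable]: "\<And>i. i \<in> I \<Longrightarrow> U i \<in> borel_measurable M" using insert.prems by auto
  have "(CLINT \<omega>|M. (G \<omega> * indicator (A j) (U j \<omega>)) * (\<Prod>i\<in>I. indicator (A i) (U i \<omega>))) = 0"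
  proof (rule insert.IH)
    show "integrable M (\<lambda>\<omega>. G \<omega> * indicator (A j) (U j \<omega>))"
      by (rule Bochner_Integration.integrable_bound[OF insert.prems(1)]) (auto simp: indicator_def)
  next
    fix t
    have sm: "(\<lambda>\<omega>. \<Sum>i\<in>I. t i * U i \<omega>) \<in> borel_measurable M" by measurable
    \<comment> \<open>Only coordinate \<open>j\<close> is converted here; the exponential of the
      remaining coordinates counts as part of the weight.\<close>
    have "(CLINT \<omega>|M. (G \<omega> * iexp (\<Sum>i\<in>I. t i * U i \<omega>)) * indicator (A j) (U j \<omega>)) = 0"
    proof (rule char_zero_imp_indicator_zero)
      show "integrable M (\<lambda>\<omega>. G \<omega> * iexp (\<Sum>i\<in>I. t i * U i \<omega>))"
        by (rule Bochner_Integration.integrable_bound[OF insert.prems(1)])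
          (use sm in \<open>auto simp: norm_mult simp del: of_real_sum\<close>)
    next
      fix \<tau>
      have "(\<Sum>i\<in>insert j I. (t(j := \<tau>)) i * U i \<omega>) = \<tau> * U j \<omega> + (\<Sum>i\<in>I. t i * U i \<omega>)" for \<omega>
        using insert.hyps by (auto intro!: sum.cong)
      then show "(CLINT \<omega>|M. (G \<omega> * iexp (\<Sum>i\<in>I. t i * U i \<omega>)) * iexp (\<tau> * U j \<omega>)) = 0"
        using insert.prems(3)[of "t(j := \<tau>)"]
        by (simp add: distrib_left exp_add mult_ac del: of_real_sum fun_upd_apply)
    qed auto
    then show "(CLINT \<omega>|M. (G \<omega> * indicator (A j) (U j \<omega>)) * iexp (\<Sum>i\<in>I. t i * U i \<omega>)) = 0"
      by (simp add: mult_ac del: of_real_sum)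
  qed (use insert.prems in auto)
  then show ?case using insert.hyps by (simp add: mult_ac)
qed

section \<open>Conditional variance of Gaussian processes\<close>

lemma (in prob_space) gaussian_rv_square_integrable:
  assumes "gaussian_rv M Z"
  shows "integrable M Z" "integrable M (\<lambda>\<omega>. (Z \<omega>)\<^sup>2)"
proof -
  have [measurable]: "Z \<in> borel_measurable M" using assms by (simp add: gaussian_rv_def)
  consider (const) c where "AE \<omega> in M. Z \<omega> = c"
    | (normal) \<mu> \<sigma> where "0 < \<sigma>" "distributed M lborel Z (normal_density \<mu> \<sigma>)"
    using assms by (auto simp: gaussian_rv_def)
  then have "integrable M Z \<and> integrable M (\<lambda>\<omega>. (Z \<omega>)\<^sup>2)"
  proof cases
    case const
    have "integrable M Z \<longleftrightarrow> integrable M (\<lambda>_. c)"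
      by (rule integrable_cong_AE) (use const in auto)
    moreover have "integrable M (\<lambda>\<omega>. (Z \<omega>)\<^sup>2) \<longleftrightarrow> integrable M (\<lambda>_. c\<^sup>2)"
      by (rule integrable_cong_AE) (use const in auto)
    ultimately show ?thesis by simp
  next
    case normal
    have i1: "integrable lborel (\<lambda>x. normal_density \<mu> \<sigma> x * x)"
      using integrable_normal_moment_nz_1 normal by blast
    \<comment> \<open>Since x^2 = (x - mu)^2 + 2 mu x - mu^2, the second moment about zero reduces
      to known moments; the exponent \<open>0\<close> stands for the total mass.\<close>
    have "integrable lborel (\<lambda>x. normal_density \<mu> \<sigma> x * (x - \<mu>)^2 + (2 * \<mu>) * (normal_density \<mu> \<sigma> x * x)
       - \<mu>\<^sup>2 * (normal_density \<mu> \<sigma> x * (x - \<mu>)^0))"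
      using i1 integrable_normal_moment[OF normal(1), of \<mu> 2] integrable_normal_moment[OF normal(1), of \<mu> 0]
      by (intro Bochner_Integration.integrable_diff Bochner_Integration.integrable_add integrable_mult_right)
    also have "(\<lambda>x. normal_density \<mu> \<sigma> x * (x - \<mu>)^2 + (2 * \<mu>) * (normal_density \<mu> \<sigma> x * x)
       - \<mu>\<^sup>2 * (normal_density \<mu> \<sigma> x * (x - \<mu>)^0)) = (\<lambda>x. normal_density \<mu> \<sigma> x * x\<^sup>2)"
      by (auto simp: fun_eq_iff power2_eq_square algebra_simps)
    finally have i2: "integrable lborel (\<lambda>x. normal_density \<mu> \<sigma> x * x\<^sup>2)" .
    show ?thesis
      using i1 i2 distributed_integrable[OF normal(2), of "\<lambda>x. x"]
        distributed_integrable[OF normal(2), of "\<lambda>x. x\<^sup>2"] by simp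
  qed
  then show "integrable M Z" "integrable M (\<lambda>\<omega>. (Z \<omega>)\<^sup>2)" by auto
qed

text \<open>A centred constant vanishes almost surely and both sides are 1; otherwise division by
  the standard deviation reduces the claim to the standard normal law.\<close>

lemma (in prob_space) gaussian_rv_char:
  assumes "gaussian_rv M Z" "expectation Z = 0"
  shows "(CLINT \<omega>|M. iexp (Z \<omega>)) = complex_of_real (exp (- expectation (\<lambda>\<omega>. (Z \<omega>)\<^sup>2) / 2))"
proof -
  have [measurable]: "Z \<in> borel_measurable M" using assms by (simp add: gaussian_rv_def)
  consider (const) c where "AE \<omega> in M. Z \<omega> = c"
    | (normal) \<mu> \<sigma> where "0 < \<sigma>" "distributed M lborel Z (normal_density \<mu> \<sigma>)"
    using assms by (auto simp: gaussian_rv_def)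
  then show ?thesis
  proof cases
    case const
    have "expectation Z = expectation (\<lambda>_. c)" by (rule integral_cong_AE) (use const in auto)
    then have "c = 0" using assms by (simp add: prob_space)
    have "(CLINT \<omega>|M. iexp (Z \<omega>)) = (CLINT \<omega>|M. 1)"
      by (rule integral_cong_AE) (use const \<open>c = 0\<close> in auto)
    moreover have "expectation (\<lambda>\<omega>. (Z \<omega>)\<^sup>2) = expectation (\<lambda>_. 0)"
      by (rule integral_cong_AE) (use const \<open>c = 0\<close> in auto)
    ultimately show ?thesis by (simp add: prob_space)
  next
    case normal
    have mu: "\<mu> = 0" using normal_distributed_expectation[OF normal] assms by simp
    have var: "expectation (\<lambda>\<omega>. (Z \<omega>)\<^sup>2) = \<sigma>\<^sup>2"
      using normal_distributed_variance[OF normal] assms by simp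
    have "distributed M lborel (\<lambda>\<omega>. Z \<omega> / \<sigma>) std_normal_density"
      using normal normal_standard_normal_convert[OF normal(1), of Z 0] mu by simp
    then have d: "distr M lborel (\<lambda>\<omega>. Z \<omega> / \<sigma>) = std_normal_distribution"
      by (simp add: distributed_distr_eq_density)
    have "(CLINT \<omega>|M. iexp (Z \<omega>)) = (CLINT \<omega>|M. iexp (\<sigma> * (Z \<omega> / \<sigma>)))"
      using normal(1) by simp
    also have "\<dots> = (CLINT x|distr M lborel (\<lambda>\<omega>. Z \<omega> / \<sigma>). iexp (\<sigma> * x))"
      by (subst integral_distr) auto
    also have "\<dots> = char std_normal_distribution \<sigma>"
      unfolding d char_def ..
    finally show ?thesis by (simp add: char_std_normal_distribution var)
  qed
qed

section \<open>Linear combinations of a process and their second moments\<close>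

text \<open>The linear span of the observations, taken as a set of functions and not modulo null
  sets, so that membership follows from a formula.\<close>

definition lincombs :: "('i \<Rightarrow> 'w \<Rightarrow> real) \<Rightarrow> 'i set \<Rightarrow> ('w \<Rightarrow> real) set" where
  "lincombs Y T = {Z. \<exists>S c. finite S \<and> S \<subseteq> T \<and> Z = (\<lambda>\<omega>. \<Sum>s\<in>S. c s * Y s \<omega>)}"

lemma lincombs_sum: "finite S \<Longrightarrow> S \<subseteq> T \<Longrightarrow> (\<lambda>\<omega>. \<Sum>s\<in>S. c s * Y s \<omega>) \<in> lincombs Y T"
  unfolding lincombs_def by auto

lemma lincombs_mono: "Z \<in> lincombs Y S \<Longrightarrow> S \<subseteq> T \<Longrightarrow> Z \<in> lincombs Y T"
  unfolding lincombs_def by blast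

lemma lincombs_base: "s \<in> T \<Longrightarrow> Y s \<in> lincombs Y T"
  using lincombs_sum[of "{s}" T "\<lambda>_. 1" Y] by simp

lemma lincombs_zero: "(\<lambda>_. 0) \<in> lincombs Y T"
  using lincombs_sum[of "{}" T _ Y] by simp

lemma lincombs_scale: "Z \<in> lincombs Y T \<Longrightarrow> (\<lambda>\<omega>. a * Z \<omega>) \<in> lincombs Y T"
proof -
  assume "Z \<in> lincombs Y T"
  then obtain S c where "finite S" "S \<subseteq> T" "Z = (\<lambda>\<omega>. \<Sum>s\<in>S. c s * Y s \<omega>)"
    unfolding lincombs_def by auto
  then show ?thesis using lincombs_sum[of S T "\<lambda>s. a * c s" Y] by (simp add: sum_distrib_left mult.assoc)
qed

lemma lincombs_add:
  assumes "Z \<in> lincombs Y T" "W \<in> lincombs Y T"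
  shows "(\<lambda>\<omega>. Z \<omega> + W \<omega>) \<in> lincombs Y T"
proof -
  obtain S c where S: "finite S" "S \<subseteq> T" "Z = (\<lambda>\<omega>. \<Sum>s\<in>S. c s * Y s \<omega>)"
    using assms unfolding lincombs_def by auto
  obtain S' c' where S': "finite S'" "S' \<subseteq> T" "W = (\<lambda>\<omega>. \<Sum>s\<in>S'. c' s * Y s \<omega>)"
    using assms unfolding lincombs_def by auto
  \<comment> \<open>Both coefficient families are extended by zero to the union of the two
    supports.\<close>
  have *: "(\<Sum>s\<in>A. d s * Y s \<omega>) = (\<Sum>s\<in>S \<union> S'. (if s \<in> A then d s else 0) * Y s \<omega>)"
    if "A \<subseteq> S \<union> S'" for A d \<omega>
    using that S S' by (intro sum.mono_neutral_cong_left) auto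
  have "Z \<omega> + W \<omega> = (\<Sum>s\<in>S \<union> S'. ((if s \<in> S then c s else 0) + (if s \<in> S' then c' s else 0)) * Y s \<omega>)" for \<omega>
    unfolding S S' using *[of S c \<omega>] *[of S' c' \<omega>] by (simp add: sum.distrib distrib_right)
  then show ?thesis using S S' lincombs_sum[of "S \<union> S'" T _ Y] by simp
qed

lemma lincombs_diff:
  assumes "Z \<in> lincombs Y T" "W \<in> lincombs Y T"
  shows "(\<lambda>\<omega>. Z \<omega> - W \<omega>) \<in> lincombs Y T"
  using lincombs_add[OF assms(1) lincombs_scale[OF assms(2), of "-1"]] by simp

lemma lincombs_sum_closed:
  assumes "\<And>i. i \<in> I \<Longrightarrow> Z i \<in> lincombs Y T"
  shows "(\<lambda>\<omega>. \<Sum>i\<in>I. Z i \<omega>) \<in> lincombs Y T"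
  using assms by (induction I rule: infinite_finite_induct) (auto intro: lincombs_zero lincombs_add)

locale centered_gaussian_process =
  fixes M :: "'w measure" and D :: "'i set" and Y :: "'i \<Rightarrow> 'w \<Rightarrow> real" and k :: "'i \<Rightarrow> 'i \<Rightarrow> real"
  assumes gaussian: "gaussian_process M D Y"
    and mean_zero: "has_mean_zero M D Y"
    and covariance: "has_covariance M D Y k"

sublocale centered_gaussian_process \<subseteq> prob_space M
  using gaussian by (simp add: gaussian_process_def)

context centered_gaussian_process
begin

lemma lincombs_gaussian: "Z \<in> lincombs Y D \<Longrightarrow> gaussian_rv M Z"
  using gaussian by (auto simp: gaussian_process_def lincombs_def)

lemma lincombs_measurable [measurable]: "Z \<in> lincombs Y D \<Longrightarrow> Z \<in> borel_measurable M"
  using lincombs_gaussian by (auto simp: gaussian_rv_def)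

lemma measurable_process [measurable]: "s \<in> D \<Longrightarrow> Y s \<in> borel_measurable M"
  using lincombs_base[of s D Y] by auto

lemma lincombs_integrable: "Z \<in> lincombs Y D \<Longrightarrow> integrable M Z"
  using lincombs_gaussian gaussian_rv_square_integrable by blast

lemma lincombs_prod_integrable:
  assumes "Z \<in> lincombs Y D" "W \<in> lincombs Y D"
  shows "integrable M (\<lambda>\<omega>. Z \<omega> * W \<omega>)"
proof -
  have [measurable]: "Z \<in> borel_measurable M" "W \<in> borel_measurable M" using assms by auto
  show ?thesis
  proof (rule Bochner_Integration.integrable_bound)
    show "integrable M (\<lambda>\<omega>. (Z \<omega>)\<^sup>2 + (W \<omega>)\<^sup>2)"
      using assms lincombs_gaussian gaussian_rv_square_integrable by auto
    have "\<bar>a * b\<bar> \<le> a\<^sup>2 + b\<^sup>2" for a b :: real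
    proof -
      have "0 \<le> (\<bar>a\<bar> - \<bar>b\<bar>)\<^sup>2" by simp
      then have "2 * (\<bar>a\<bar> * \<bar>b\<bar>) \<le> a\<^sup>2 + b\<^sup>2" by (simp add: power2_diff)
      moreover have "0 \<le> \<bar>a\<bar> * \<bar>b\<bar>" by simp
      ultimately show ?thesis unfolding abs_mult by linarith
    qed
    then show "AE \<omega> in M. norm (Z \<omega> * W \<omega>) \<le> norm ((Z \<omega>)\<^sup>2 + (W \<omega>)\<^sup>2)" by simp
  qed simp
qed

lemma lincombs_square_integrable: "Z \<in> lincombs Y D \<Longrightarrow> integrable M (\<lambda>\<omega>. (Z \<omega>)\<^sup>2)"
  using lincombs_prod_integrable[of Z Z] by (simp add: power2_eq_square)

lemma expectation_process_prod: "s \<in> D \<Longrightarrow> t \<in> D \<Longrightarrow> expectation (\<lambda>\<omega>. Y s \<omega> * Y t \<omega>) = k s t"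
  using covariance mean_zero by (simp add: has_covariance_def has_mean_zero_def)

lemma covariance_sym: "s \<in> D \<Longrightarrow> t \<in> D \<Longrightarrow> k s t = k t s"
  using expectation_process_prod[of s t] expectation_process_prod[of t s] by (simp add: mult.commute)

lemma lincombs_expectation: "Z \<in> lincombs Y D \<Longrightarrow> expectation Z = 0"
  using mean_zero lincombs_integrable[OF lincombs_base[of _ D Y]]
  by (auto simp: lincombs_def has_mean_zero_def subset_iff)

lemma lincombs_char:
  "Z \<in> lincombs Y D \<Longrightarrow>
   (CLINT \<omega>|M. iexp (Z \<omega>)) = complex_of_real (exp (- expectation (\<lambda>\<omega>. (Z \<omega>)\<^sup>2) / 2))"
  using gaussian_rv_char lincombs_gaussian lincombs_expectation by blast

lemma expectation_square_add:
  assumes "Z \<in> lincombs Y D" "W \<in> lincombs Y D"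
  shows "expectation (\<lambda>\<omega>. (Z \<omega> + W \<omega>)\<^sup>2) = expectation (\<lambda>\<omega>. (Z \<omega>)\<^sup>2)
    + 2 * expectation (\<lambda>\<omega>. Z \<omega> * W \<omega>) + expectation (\<lambda>\<omega>. (W \<omega>)\<^sup>2)"
proof -
  have "(\<lambda>\<omega>. (Z \<omega> + W \<omega>)\<^sup>2) = (\<lambda>\<omega>. (Z \<omega>)\<^sup>2 + 2 * (Z \<omega> * W \<omega>) + (W \<omega>)\<^sup>2)"
    by (auto simp: power2_sum)
  then show ?thesis
    using lincombs_square_integrable[OF assms(1)] lincombs_square_integrable[OF assms(2)]
      lincombs_prod_integrable[OF assms] by simp
qed

lemma expectation_lincombs_prod:
  assumes Z: "Z \<in> lincombs Y D" and S: "finite S" "S \<subseteq> D"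
  shows "expectation (\<lambda>\<omega>. Z \<omega> * (\<Sum>s\<in>S. c s * Y s \<omega>)) = (\<Sum>s\<in>S. c s * expectation (\<lambda>\<omega>. Z \<omega> * Y s \<omega>))"
proof -
  have "(\<lambda>\<omega>. Z \<omega> * (\<Sum>s\<in>S. c s * Y s \<omega>)) = (\<lambda>\<omega>. \<Sum>s\<in>S. c s * (Z \<omega> * Y s \<omega>))"
    by (auto simp: sum_distrib_left mult_ac)
  moreover have "integrable M (\<lambda>\<omega>. c s * (Z \<omega> * Y s \<omega>))" if "s \<in> S" for s
    using lincombs_prod_integrable[OF Z lincombs_base[of s D Y]] that S by auto
  ultimately show ?thesis by (simp add: Bochner_Integration.integral_sum)
qed

lemma orthogonal_lincombs:
  assumes "Z \<in> lincombs Y D" "T \<subseteq> D" "\<And>t. t \<in> T \<Longrightarrow> expectation (\<lambda>\<omega>. Z \<omega> * Y t \<omega>) = 0" "W \<in> lincombs Y T"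
  shows "expectation (\<lambda>\<omega>. Z \<omega> * W \<omega>) = 0"
  using assms by (auto simp: lincombs_def[of Y T] expectation_lincombs_prod subset_iff intro!: sum.neutral)

text \<open>The joint characteristic function factors.\<close>

lemma indep_residual:
  assumes I: "finite (I :: 'j set)" "\<And>i. i \<in> I \<Longrightarrow> x i \<in> D" and R: "R \<in> lincombs Y D"
    and orth: "\<And>i. i \<in> I \<Longrightarrow> expectation (\<lambda>\<omega>. R \<omega> * Y (x i) \<omega>) = 0"
  shows "indep_set (sets (generated_by M I (\<lambda>i. Y (x i))))
           (sigma_sets (space M) {R -` A \<inter> space M | A. A \<in> sets borel})"
proof -
  let ?f = "\<lambda>\<omega>. \<lambda>i\<in>I. Y (x i) \<omega>"
  have Rm [measurable]: "R \<in> borel_measurable M" using R by auto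
  have Ym [measurable]: "\<And>i. i \<in> I \<Longrightarrow> Y (x i) \<in> borel_measurable M" using I by auto
  have fm [measurable]: "?f \<in> measurable M (Pi\<^sub>M I (\<lambda>_. borel))" by (rule measurable_restrict) simp
  have box: "prob ({\<omega>\<in>space M. \<forall>i\<in>I. Y (x i) \<omega> \<in> A i} \<inter> (R -` B \<inter> space M)) =
     prob {\<omega>\<in>space M. \<forall>i\<in>I. Y (x i) \<omega> \<in> A i} * prob (R -` B \<inter> space M)"
    if A [measurable]: "\<And>i. i \<in> I \<Longrightarrow> A i \<in> sets borel" and B [measurable]: "B \<in> sets borel" for A B
  proof -
    define E where "E = {\<omega>\<in>space M. \<forall>i\<in>I. Y (x i) \<omega> \<in> A i}"
    have E [measurable]: "E \<in> sets M" unfolding E_def using I(1) by measurable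
    have ind: "(\<Prod>i\<in>I. indicator (A i) (Y (x i) \<omega>)) = (indicator E \<omega> :: complex)" if "\<omega> \<in> space M" for \<omega>
      using that I(1) by (auto simp: E_def indicator_def)
    have ie_int: "integrable M (\<lambda>\<omega>. iexp (Z \<omega>))" if "Z \<in> borel_measurable M" for Z
      by (rule Bochner_Integration.integrable_bound[of M "\<lambda>_. 1 :: real"]) (use that in auto)
    \<comment> \<open>This is the independence of \<open>E\<close> and the event that
      \<open>R\<close> lies in \<open>B\<close>. Exponentials are turned into indicators twice:
      first in the observations, with the centred exponential of \<open>R\<close> as weight, and
      then in \<open>R\<close>, with the centred indicator of \<open>E\<close> as weight.\<close>
    have *: "(LINT \<omega>|M. (indicator E \<omega> - prob E) * indicator B (R \<omega>)) = 0"
    proof (rule char_zero_imp_indicator_zero_real)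
      fix s
      define c where "c = (CLINT \<omega>|M. iexp (s * R \<omega>))"
      have sR: "(\<lambda>\<omega>. s * R \<omega>) \<in> lincombs Y D" using R by (rule lincombs_scale)
      have "(CLINT \<omega>|M. (iexp (s * R \<omega>) - c) * (\<Prod>i\<in>I. indicator (A i) (Y (x i) \<omega>))) = 0"
      proof (rule char_zero_imp_box_zero)
        show "integrable M (\<lambda>\<omega>. iexp (s * R \<omega>) - c)"
          using ie_int[of "\<lambda>\<omega>. s * R \<omega>"] by simp
      next
        fix t
        define W where "W = (\<lambda>\<omega>. \<Sum>i\<in>I. t i * Y (x i) \<omega>)"
        have W: "W \<in> lincombs Y D" "W \<in> lincombs Y (x ` I)" unfolding W_def
          using I by (auto intro!: lincombs_sum_closed lincombs_scale lincombs_base)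
        have [measurable]: "W \<in> borel_measurable M" using W by auto
        \<comment> \<open>Orthogonality removes the cross term, so second moments add; the Gaussian
          formula for characteristic functions turns this sum into a product.\<close>
        have "expectation (\<lambda>\<omega>. s * R \<omega> * W \<omega>) = 0"
          using orthogonal_lincombs[OF R _ _ W(2)] orth I by (auto simp: mult.assoc)
        then have "(CLINT \<omega>|M. iexp (s * R \<omega> + W \<omega>)) = c * (CLINT \<omega>|M. iexp (W \<omega>))"
          unfolding c_def lincombs_char[OF sR] lincombs_char[OF W(1)]
            lincombs_char[OF lincombs_add[OF sR W(1)]] expectation_square_add[OF sR W(1)]
          by (simp flip: exp_add exp_of_real add: add_divide_distrib diff_divide_distrib)
        moreover have "(CLINT \<omega>|M. (iexp (s * R \<omega>) - c) * iexp (W \<omega>)) =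
            (CLINT \<omega>|M. iexp (s * R \<omega> + W \<omega>) - c * iexp (W \<omega>))"
          by (simp add: left_diff_distrib distrib_left exp_add)
        moreover have "\<dots> = (CLINT \<omega>|M. iexp (s * R \<omega> + W \<omega>)) - (CLINT \<omega>|M. c * iexp (W \<omega>))"
          by (intro Bochner_Integration.integral_diff integrable_mult_right ie_int) auto
        ultimately show "(CLINT \<omega>|M. (iexp (s * R \<omega>) - c) * iexp (\<Sum>i\<in>I. t i * Y (x i) \<omega>)) = 0"
          by (simp add: W_def)
      qed (use I A in auto)
      also have "(CLINT \<omega>|M. (iexp (s * R \<omega>) - c) * (\<Prod>i\<in>I. indicator (A i) (Y (x i) \<omega>))) =
          (CLINT \<omega>|M. iexp (s * R \<omega>) * indicator E \<omega> - c * indicator E \<omega>)"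
        by (intro Bochner_Integration.integral_cong) (auto simp: ind left_diff_distrib)
      also have "\<dots> = (CLINT \<omega>|M. iexp (s * R \<omega>) * indicator E \<omega>) - (CLINT \<omega>|M. c * indicator E \<omega>)"
      proof (rule Bochner_Integration.integral_diff)
        show "integrable M (\<lambda>\<omega>. iexp (s * R \<omega>) * indicator E \<omega>)"
          by (rule Bochner_Integration.integrable_bound[of M "\<lambda>_. 1 :: real"]) (auto simp: indicator_def)
        show "integrable M (\<lambda>\<omega>. c * indicator E \<omega>)"
          by (rule Bochner_Integration.integrable_bound[of M "\<lambda>_. norm c"]) (auto simp: indicator_def)
      qed
      also have "(CLINT \<omega>|M. c * indicator E \<omega>) = c * prob E"
        using integral_complex_of_real[of M "indicator E"] E by (simp add: of_real_indicator)
      finally have 1: "(CLINT \<omega>|M. iexp (s * R \<omega>) * indicator E \<omega>) = c * prob E" by simp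
      have "(CLINT \<omega>|M. complex_of_real (indicator E \<omega> - prob E) * iexp (s * R \<omega>)) =
         (CLINT \<omega>|M. iexp (s * R \<omega>) * indicator E \<omega> - prob E * iexp (s * R \<omega>))"
        by (intro Bochner_Integration.integral_cong) (auto simp: algebra_simps of_real_indicator)
      also have "\<dots> = (CLINT \<omega>|M. iexp (s * R \<omega>) * indicator E \<omega>) - (CLINT \<omega>|M. prob E * iexp (s * R \<omega>))"
      proof (rule Bochner_Integration.integral_diff)
        show "integrable M (\<lambda>\<omega>. iexp (s * R \<omega>) * indicator E \<omega>)"
          by (rule Bochner_Integration.integrable_bound[of M "\<lambda>_. 1 :: real"]) (auto simp: indicator_def)
        show "integrable M (\<lambda>\<omega>. complex_of_real (prob E) * iexp (s * R \<omega>))"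
          by (intro integrable_mult_right ie_int) auto
      qed
      also have "\<dots> = 0" unfolding 1 integral_mult_right_zero c_def by simp
      finally show "(CLINT \<omega>|M. complex_of_real (indicator E \<omega> - prob E) * iexp (s * R \<omega>)) = 0" .
    qed (auto intro!: Bochner_Integration.integrable_diff integrable_real_indicator simp: emeasure_eq_measure)
    define F where "F = R -` B \<inter> space M"
    have F [measurable]: "F \<in> sets M" unfolding F_def by measurable
    have "0 = (LINT \<omega>|M. indicator (E \<inter> F) \<omega> - prob E * indicator F \<omega>)"
      unfolding *[symmetric]
      by (intro Bochner_Integration.integral_cong) (auto simp: F_def indicator_def)
    also have "\<dots> = prob (E \<inter> F) - prob E * prob F"
      by (subst Bochner_Integration.integral_diff)
        (auto intro!: integrable_real_indicator integrable_mult_right simp: emeasure_eq_measure)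
    finally show ?thesis unfolding E_def F_def by simp
  qed
  have f_space: "?f \<in> space M \<rightarrow> (\<Pi>\<^sub>E i\<in>I. space borel)" by auto
  \<comment> \<open>Preimages of measurable boxes form an intersection-stable generator, so the
    product formula \<open>box\<close> is enough for independence.\<close>
  have gen1: "sets (generated_by M I (\<lambda>i. Y (x i))) =
      sigma_sets (space M) {?f -` A \<inter> space M | A. A \<in> prod_algebra I (\<lambda>_. borel :: real measure)}"
    unfolding generated_by_def sigma_sets_vimage_commute[OF f_space, symmetric] sets_PiM[symmetric]
    by (rule sets_vimage_algebra2) (auto simp: space_PiM)
  have "indep_set {?f -` A \<inter> space M | A. A \<in> prod_algebra I (\<lambda>_. borel)} {R -` A \<inter> space M | A. A \<in> sets borel}"
  proof (rule indep_setI)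
    show "{?f -` A \<inter> space M | A. A \<in> prod_algebra I (\<lambda>_. borel)} \<subseteq> events"
      using fm unfolding sets_PiM[symmetric] by (auto simp: sets_PiM intro!: measurable_sets[OF fm])
    show "{R -` A \<inter> space M | A. A \<in> sets borel} \<subseteq> events" by auto
  next
    fix a b assume a: "a \<in> {?f -` A \<inter> space M | A. A \<in> prod_algebra I (\<lambda>_. borel)}"
      and b: "b \<in> {R -` A \<inter> space M | A. A \<in> sets borel}"
    obtain A where A: "\<And>i. i \<in> I \<Longrightarrow> A i \<in> sets borel" and aA: "a = ?f -` (\<Pi>\<^sub>E i\<in>I. A i) \<inter> space M"
      using a by (auto simp: prod_algebra_eq_finite[OF I(1)])
    have a': "a = {\<omega>\<in>space M. \<forall>i\<in>I. Y (x i) \<omega> \<in> A i}" unfolding aA by (auto simp: PiE_iff)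
    obtain B where "B \<in> sets borel" "b = R -` B \<inter> space M" using b by auto
    then show "prob (a \<inter> b) = prob a * prob b" unfolding a' using box[of A B] A by simp
  qed
  moreover have "Int_stable {?f -` A \<inter> space M | A. A \<in> prod_algebra I (\<lambda>_. borel :: real measure)}"
  proof (rule Int_stableI)
    fix a b assume "a \<in> {?f -` A \<inter> space M | A. A \<in> prod_algebra I (\<lambda>_. borel :: real measure)}"
      "b \<in> {?f -` A \<inter> space M | A. A \<in> prod_algebra I (\<lambda>_. borel :: real measure)}"
    then obtain A B where A: "A \<in> prod_algebra I (\<lambda>_. borel :: real measure)" "a = ?f -` A \<inter> space M"
      and B: "B \<in> prod_algebra I (\<lambda>_. borel :: real measure)" "b = ?f -` B \<inter> space M" by auto
    have "A \<inter> B \<in> prod_algebra I (\<lambda>_. borel :: real measure)"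
      using Int_stable_prod_algebra A(1) B(1) unfolding Int_stable_def by blast
    moreover have "a \<inter> b = ?f -` (A \<inter> B) \<inter> space M" using A B by auto
    ultimately show "a \<inter> b \<in> {?f -` A \<inter> space M | A. A \<in> prod_algebra I (\<lambda>_. borel :: real measure)}" by blast
  qed
  moreover have "Int_stable {R -` A \<inter> space M | A. A \<in> sets borel}"
  proof (rule Int_stableI)
    fix a b assume "a \<in> {R -` A \<inter> space M | A. A \<in> sets borel}" "b \<in> {R -` A \<inter> space M | A. A \<in> sets borel}"
    then obtain A B where "A \<in> sets borel" "a = R -` A \<inter> space M" "B \<in> sets borel" "b = R -` B \<inter> space M" by auto
    then have "A \<inter> B \<in> sets borel" "a \<inter> b = R -` (A \<inter> B) \<inter> space M" by auto
    then show "a \<inter> b \<in> {R -` A \<inter> space M | A. A \<in> sets borel}" by blast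
  qed
  ultimately have "indep_set
     (sigma_sets (space M) {?f -` A \<inter> space M | A. A \<in> prod_algebra I (\<lambda>_. borel :: real measure)})
     (sigma_sets (space M) {R -` A \<inter> space M | A. A \<in> sets borel})"
    by (rule indep_set_sigma_sets)
  then show ?thesis unfolding gen1 .
qed

text \<open>The residual is independent of the observations, so \<open>P\<close> is a version of the
  conditional expectation and the conditional mean of the squared residual is its plain mean. No
  matrix is inverted and \<open>x\<close> may repeat points, as the sequences in the NEB property
  may.\<close>

lemma cond_var_residual:
  assumes I: "finite (I :: 'j set)" "\<And>i. i \<in> I \<Longrightarrow> x i \<in> D" and x0: "x0 \<in> D"
    and P: "P \<in> lincombs Y (x ` I)"
    and orth: "\<And>i. i \<in> I \<Longrightarrow> expectation (\<lambda>\<omega>. (Y x0 \<omega> - P \<omega>) * Y (x i) \<omega>) = 0"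
  shows "AE \<omega> in M. cond_var M (generated_by M I (\<lambda>i. Y (x i))) (Y x0) \<omega>
           = expectation (\<lambda>\<omega>. (Y x0 \<omega> - P \<omega>)\<^sup>2)"
proof -
  let ?f = "\<lambda>\<omega>. \<lambda>i\<in>I. Y (x i) \<omega>"
  define F where "F = generated_by M I (\<lambda>i. Y (x i))"
  define R where "R = (\<lambda>\<omega>. Y x0 \<omega> - P \<omega>)"
  have PD: "P \<in> lincombs Y D" using P I(2) by (auto intro: lincombs_mono)
  have YD: "Y x0 \<in> lincombs Y D" using x0 by (rule lincombs_base)
  have RD: "R \<in> lincombs Y D" unfolding R_def using YD PD by (rule lincombs_diff)
  have [measurable]: "P \<in> borel_measurable M" "Y x0 \<in> borel_measurable M" "R \<in> borel_measurable M"
    using PD YD RD by auto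
  have Ym [measurable]: "\<And>i. i \<in> I \<Longrightarrow> Y (x i) \<in> borel_measurable M" using I by auto
  have fm [measurable]: "?f \<in> measurable M (Pi\<^sub>M I (\<lambda>_. borel))" by (rule measurable_restrict) simp
  have setsF: "sets F = {?f -` A \<inter> space M | A. A \<in> sets (Pi\<^sub>M I (\<lambda>_. borel))}"
    unfolding F_def generated_by_def
    by (rule sets_vimage_algebra2) (auto simp: space_PiM)
  have spF: "space F = space M" by (simp add: F_def generated_by_def)
  have sub: "subalgebra M F" unfolding subalgebra_def setsF spF by (auto intro: measurable_sets[OF fm])
  interpret fs: finite_measure_subalgebra M F
    by unfold_locales (rule sub)
  have fF: "?f \<in> measurable F (Pi\<^sub>M I (\<lambda>_. borel))"
    unfolding F_def generated_by_def by (rule measurable_vimage_algebra1) (auto simp: space_PiM)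
  have YF: "Y (x i) \<in> borel_measurable F" if "i \<in> I" for i
  proof -
    have "(\<lambda>\<omega>. ?f \<omega> i) \<in> borel_measurable F"
      using measurable_compose[OF fF measurable_component_singleton[OF that]] .
    then show ?thesis using that by simp
  qed
  obtain S c where S: "finite S" "S \<subseteq> x ` I" "P = (\<lambda>\<omega>. \<Sum>s\<in>S. c s * Y s \<omega>)"
    using P unfolding lincombs_def by auto
  have PF: "P \<in> borel_measurable F"
    unfolding S(3) using S(2) YF by (intro borel_measurable_sum borel_measurable_times) auto
  have indep: "indep_set (sets F) (sigma_sets (space M) {R -` A \<inter> space M | A. A \<in> sets borel})"
    unfolding F_def by (rule indep_residual[OF I RD]) (use orth in \<open>auto simp: R_def\<close>)
  \<comment> \<open>The averaging identity behind both conditional expectations below: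
    \<open>h\<close> is the identity for the conditional mean and the square for the conditional
    variance.\<close>
  have key: "(\<integral>\<omega>\<in>A. h (R \<omega>) \<partial>M) = prob A * expectation (\<lambda>\<omega>. h (R \<omega>))"
    if "A \<in> sets F" and h [measurable]: "h \<in> borel_measurable borel" and hi: "integrable M (\<lambda>\<omega>. h (R \<omega>))" for A h
  proof -
    have Am: "A \<in> sets M" using that(1) sub by (auto simp: subalgebra_def)
    \<comment> \<open>The indicator of \<open>A\<close> generates a sub-algebra of \<open>F\<close>,
      so it is independent of \<open>R\<close> as a random variable and expectations
      multiply.\<close>
    have sF: "sigma_sets (space M) {indicat_real A -` X \<inter> space M | X. X \<in> sets borel} \<subseteq> sets F"
      unfolding spF[symmetric] using that(1)
      by (intro sets.sigma_sets_subset) (auto intro!: measurable_sets borel_measurable_indicator)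
    have "indep_set (sigma_sets (space M) {indicat_real A -` X \<inter> space M | X. X \<in> sets borel})
        (sigma_sets (space M) {R -` X \<inter> space M | X. X \<in> sets borel})"
      using indep indep_setD_ev1[OF indep] indep_setD_ev2[OF indep] sF
      by (intro indep_setI) (auto intro: indep_setD[OF indep])
    then have "indep_var borel (indicat_real A) borel R"
      unfolding indep_var_eq using Am by simp
    from indep_var_compose[OF this, of "\<lambda>z. z" borel h borel]
    have iv: "indep_var borel (indicat_real A) borel (\<lambda>\<omega>. h (R \<omega>))"
      by (simp add: comp_def)
    have "(\<integral>\<omega>\<in>A. h (R \<omega>) \<partial>M) = expectation (\<lambda>\<omega>. indicat_real A \<omega> * h (R \<omega>))"
      unfolding set_lebesgue_integral_def by simp
    also have "\<dots> = expectation (indicat_real A) * expectation (\<lambda>\<omega>. h (R \<omega>))"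
      by (rule indep_var_lebesgue_integral[OF iv _ hi])
        (use Am in \<open>auto intro!: integrable_real_indicator simp: emeasure_eq_measure\<close>)
    finally show ?thesis using Am by simp
  qed
  have Ri: "integrable M R" "integrable M (\<lambda>\<omega>. (R \<omega>)\<^sup>2)" "integrable M P"
    using RD PD lincombs_integrable lincombs_square_integrable by auto
  define V where "V = expectation (\<lambda>\<omega>. (R \<omega>)\<^sup>2)"
  have ce: "AE \<omega> in M. real_cond_exp M F (Y x0) \<omega> = P \<omega>"
  proof (rule fs.real_cond_exp_charact)
    fix A assume A: "A \<in> sets F"
    then have [measurable]: "A \<in> sets M" using sub by (auto simp: subalgebra_def)
    have "(\<integral>\<omega>\<in>A. Y x0 \<omega> \<partial>M) = (\<integral>\<omega>\<in>A. P \<omega> + R \<omega> \<partial>M)" by (simp add: R_def)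
    also have "\<dots> = (\<integral>\<omega>\<in>A. P \<omega> \<partial>M) + (\<integral>\<omega>\<in>A. R \<omega> \<partial>M)"
      by (rule set_integral_add) (use Ri in \<open>auto simp: set_integrable_def simp del: real_scaleR_def intro!: integrable_mult_indicator\<close>)
    also have "(\<integral>\<omega>\<in>A. R \<omega> \<partial>M) = 0"
      using key[OF A, of "\<lambda>r. r"] Ri lincombs_expectation[OF RD] by simp
    finally show "(\<integral>\<omega>\<in>A. Y x0 \<omega> \<partial>M) = (\<integral>\<omega>\<in>A. P \<omega> \<partial>M)" by simp
  qed (use lincombs_integrable YD PD PF in auto)
  have cm [measurable]: "real_cond_exp M F (Y x0) \<in> borel_measurable M" by simp
  have sq: "AE \<omega> in M. (Y x0 \<omega> - real_cond_exp M F (Y x0) \<omega>)\<^sup>2 = (R \<omega>)\<^sup>2"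
    using ce by eventually_elim (simp add: R_def)
  have "AE \<omega> in M. real_cond_exp M F (\<lambda>\<omega>. (R \<omega>)\<^sup>2) \<omega> = V"
  proof (rule fs.real_cond_exp_charact)
    fix A assume A: "A \<in> sets F"
    then have [measurable]: "A \<in> sets M" using sub by (auto simp: subalgebra_def)
    show "(\<integral>\<omega>\<in>A. (R \<omega>)\<^sup>2 \<partial>M) = (\<integral>\<omega>\<in>A. V \<partial>M)"
      using key[OF A, of "\<lambda>r. r\<^sup>2"] Ri by (simp add: V_def set_lebesgue_integral_def)
  qed (use Ri in auto)
  moreover have "AE \<omega> in M. real_cond_exp M F (\<lambda>\<omega>. (Y x0 \<omega> - real_cond_exp M F (Y x0) \<omega>)\<^sup>2) \<omega>
     = real_cond_exp M F (\<lambda>\<omega>. (R \<omega>)\<^sup>2) \<omega>"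
    by (rule fs.real_cond_exp_cong[OF sq]) auto
  ultimately show ?thesis unfolding cond_var_def F_def[symmetric] V_def R_def
    by eventually_elim simp
qed

end

section \<open>Kriging\<close>

text \<open>Links \<open>invertible_mat\<close> with the units of the matrix ring, in terms of which
  \<open>mat_inverse\<close> and the determinant criterion are specified.\<close>

lemma invertible_mat_iff_Units:
  fixes K :: "real mat"
  assumes K: "K \<in> carrier_mat n n"
  shows "invertible_mat K \<longleftrightarrow> K \<in> Units (ring_mat TYPE(real) n ())"
proof
  assume "invertible_mat K"
  then obtain B where B: "K * B = 1\<^sub>m n" "B * K = 1\<^sub>m (dim_row B)"
    using K by (auto simp: invertible_mat_def inverts_mat_def)
  have "dim_col B = n" using arg_cong[OF B(1), of dim_col] by simp
  moreover have "dim_row B = n" using arg_cong[OF B(2), of dim_col] K by simp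
  ultimately have "B \<in> carrier_mat n n" by auto
  then show "K \<in> Units (ring_mat TYPE(real) n ())"
    using B K unfolding Units_def ring_mat_def by auto
next
  assume "K \<in> Units (ring_mat TYPE(real) n ())"
  then obtain B where B: "B \<in> carrier_mat n n" "K * B = 1\<^sub>m n" "B * K = 1\<^sub>m n"
    unfolding Units_def ring_mat_def by auto
  have "inverts_mat K B" "inverts_mat B K" using B K by (auto simp: inverts_mat_def)
  then show "invertible_mat K" using K by (auto simp: invertible_mat_def)
qed

text \<open>Entry \<open>j\<close> of the row vector k(x,A) k(A,A)^(-1), that is, the coefficient of
  the observation at \<open>A ! j\<close> in the simple Kriging predictor.\<close>

definition krig_weight :: "('a \<Rightarrow> 'a \<Rightarrow> real) \<Rightarrow> 'a list \<Rightarrow> 'a \<Rightarrow> nat \<Rightarrow> real" where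
  "krig_weight k A x j =
     (\<Sum>i<length A. k x (A ! i) * the (mat_inverse (kmat k A A)) $$ (i, j))"

lemma the_mat_inverse_kmat:
  assumes "invertible_mat (kmat k A A)"
  shows "the (mat_inverse (kmat k A A)) \<in> carrier_mat (length A) (length A)"
    and "the (mat_inverse (kmat k A A)) * kmat k A A = 1\<^sub>m (length A)"
proof -
  have K: "kmat k A A \<in> carrier_mat (length A) (length A)" by (simp add: kmat_def)
  have "kmat k A A \<in> Units (ring_mat TYPE(real) (length A) ())"
    using assms invertible_mat_iff_Units[OF K] by simp
  then obtain B where B: "mat_inverse (kmat k A A) = Some B"
    using mat_inverse(1)[OF K, where b = "()"] by (cases "mat_inverse (kmat k A A)") auto
  with mat_inverse(2)[OF K B]
  show "the (mat_inverse (kmat k A A)) \<in> carrier_mat (length A) (length A)"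
    and "the (mat_inverse (kmat k A A)) * kmat k A A = 1\<^sub>m (length A)" by auto
qed

text \<open>One computation for three choices of \<open>C\<close>: the observed column gives the
  mean, the column of covariances with \<open>x\<close> the variance, and the covariance matrix
  itself the normal equations.\<close>

lemma krig_weight_mult:
  assumes inv: "invertible_mat (kmat k A A)" and C: "C \<in> carrier_mat (length A) m" "l < m"
  shows "(kmat k [x] A * the (mat_inverse (kmat k A A)) * C) $$ (0, l) =
    (\<Sum>j<length A. krig_weight k A x j * C $$ (j, l))"
proof -
  let ?B = "the (mat_inverse (kmat k A A))"
  note B = the_mat_inverse_kmat(1)[OF inv]
  have row: "kmat k [x] A \<in> carrier_mat 1 (length A)" by (simp add: kmat_def)
  have "(kmat k [x] A * ?B * C) $$ (0, l) = (\<Sum>j<length A. (kmat k [x] A * ?B) $$ (0, j) * C $$ (j, l))"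
  proof -
    have "(R * C) $$ (0, l) = (\<Sum>j<length A. R $$ (0, j) * C $$ (j, l))"
      if "R \<in> carrier_mat 1 (length A)" for R
      using C that by (auto simp: scalar_prod_def atLeast0LessThan intro!: sum.cong)
    then show ?thesis using B row by simp
  qed
  also have "\<dots> = (\<Sum>j<length A. krig_weight k A x j * C $$ (j, l))"
    using B by (auto simp: krig_weight_def kmat_def scalar_prod_def atLeast0LessThan intro!: sum.cong)
  finally show ?thesis .
qed

lemma krig_mean_eq_weights:
  assumes "invertible_mat (kmat k A A)"
  shows "krig_mean k Y A x = (\<lambda>\<omega>. \<Sum>j<length A. krig_weight k A x j * Y (A ! j) \<omega>)"
  unfolding krig_mean_def
  by (rule ext, subst krig_weight_mult[OF assms, where m = 1]) (auto simp: obs_col_def intro!: sum.cong)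

lemma krig_var_eq_weights:
  assumes "invertible_mat (kmat k A A)"
  shows "krig_var k A x = k x x - (\<Sum>j<length A. krig_weight k A x j * k (A ! j) x)"
  unfolding krig_var_def
  by (subst krig_weight_mult[OF assms, where m = 1]) (auto simp: kmat_def intro!: sum.cong)

text \<open>The inverse cancels against the covariance matrix. Probabilistically this says that the
  Kriging residual is uncorrelated with each observation.\<close>

lemma krig_weight_normal_equations:
  assumes inv: "invertible_mat (kmat k A A)" and l: "l < length A"
  shows "(\<Sum>j<length A. krig_weight k A x j * k (A ! j) (A ! l)) = k x (A ! l)"
proof -
  let ?B = "the (mat_inverse (kmat k A A))"
  have K: "kmat k A A \<in> carrier_mat (length A) (length A)" by (simp add: kmat_def)
  have row: "kmat k [x] A \<in> carrier_mat 1 (length A)" by (simp add: kmat_def)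
  have "(\<Sum>j<length A. krig_weight k A x j * k (A ! j) (A ! l)) = (kmat k [x] A * ?B * kmat k A A) $$ (0, l)"
    using l by (subst krig_weight_mult[OF inv K l]) (auto simp: kmat_def intro!: sum.cong)
  also have "kmat k [x] A * ?B * kmat k A A = kmat k [x] A"
    using row the_mat_inverse_kmat[OF inv]
    by (simp add: assoc_mult_mat[OF row the_mat_inverse_kmat(1)[OF inv] K])
  finally show ?thesis using l by (simp add: kmat_def)
qed

text \<open>The inverse matrix does not depend on \<open>x\<close>, so the variance is a polynomial
  expression in continuous functions of \<open>x\<close>.\<close>

lemma continuous_on_krig_var:
  fixes k :: "'a::topological_space \<Rightarrow> 'a \<Rightarrow> real"
  assumes k: "continuous_on UNIV (\<lambda>(x, y). k x y)" and inv: "invertible_mat (kmat k A A)"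
  shows "continuous_on S (krig_var k A)"
proof -
  have c: "continuous_on S (\<lambda>x. k (f x) (h x))" if "continuous_on S f" "continuous_on S h" for f h
    using continuous_on_compose2[OF k continuous_on_Pair[OF that]] by simp
  show ?thesis
    unfolding krig_var_eq_weights[OF inv, abs_def] krig_weight_def
    by (intro continuous_intros c)
qed

section \<open>Kriging as orthogonal projection\<close>

context centered_gaussian_process
begin

lemma krig_mean_lincomb:
  assumes "invertible_mat (kmat k A A)"
  shows "krig_mean k Y A x \<in> lincombs Y (set A)"
  unfolding krig_mean_eq_weights[OF assms]
  by (auto intro!: lincombs_sum_closed lincombs_scale lincombs_base)

lemma krig_mean_lincombs_D:
  "invertible_mat (kmat k A A) \<Longrightarrow> set A \<subseteq> D \<Longrightarrow> krig_mean k Y A x \<in> lincombs Y D"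
  by (rule lincombs_mono[OF krig_mean_lincomb])

text \<open>The covariance formula \<open>prod\<close> serves both claims. At an observation point
  it vanishes by the normal equations; at \<open>s = x\<close> it is the Kriging variance, and this
  is the full second moment because the residual is orthogonal to the predictor.\<close>

lemma krig_residual:
  assumes inv: "invertible_mat (kmat k A A)" and A: "set A \<subseteq> D" and x: "x \<in> D"
  shows krig_residual_orthogonal: "s \<in> set A \<Longrightarrow> expectation (\<lambda>\<omega>. (Y x \<omega> - krig_mean k Y A x \<omega>) * Y s \<omega>) = 0"
    and krig_residual_var: "expectation (\<lambda>\<omega>. (Y x \<omega> - krig_mean k Y A x \<omega>)\<^sup>2) = krig_var k A x"
proof -
  define w where "w = krig_weight k A x"
  have AD: "A ! j \<in> D" if "j < length A" for j using that A nth_mem by blast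
  have YD: "Y s \<in> lincombs Y D" if "s \<in> D" for s using that by (rule lincombs_base)
  have mD: "krig_mean k Y A x \<in> lincombs Y D" using krig_mean_lincombs_D[OF inv A] .
  have RD: "(\<lambda>\<omega>. Y x \<omega> - krig_mean k Y A x \<omega>) \<in> lincombs Y D"
    by (rule lincombs_diff[OF YD[OF x] mD])
  have prod: "expectation (\<lambda>\<omega>. (Y x \<omega> - krig_mean k Y A x \<omega>) * Y s \<omega>) =
      k x s - (\<Sum>j<length A. w j * k (A ! j) s)" if s: "s \<in> D" for s
  proof -
    have i: "integrable M (\<lambda>\<omega>. Y t \<omega> * Y s \<omega>)" if "t \<in> D" for t
      by (rule lincombs_prod_integrable[OF YD[OF that] YD[OF s]])
    have "(\<lambda>\<omega>. (Y x \<omega> - krig_mean k Y A x \<omega>) * Y s \<omega>) =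
       (\<lambda>\<omega>. Y x \<omega> * Y s \<omega> - (\<Sum>j<length A. w j * (Y (A ! j) \<omega> * Y s \<omega>)))"
      by (auto simp: krig_mean_eq_weights[OF inv] w_def left_diff_distrib sum_distrib_right mult.assoc)
    then have "expectation (\<lambda>\<omega>. (Y x \<omega> - krig_mean k Y A x \<omega>) * Y s \<omega>) =
       expectation (\<lambda>\<omega>. Y x \<omega> * Y s \<omega> - (\<Sum>j<length A. w j * (Y (A ! j) \<omega> * Y s \<omega>)))"
      by simp
    also have "\<dots> = expectation (\<lambda>\<omega>. Y x \<omega> * Y s \<omega>) -
       (\<Sum>j<length A. expectation (\<lambda>\<omega>. w j * (Y (A ! j) \<omega> * Y s \<omega>)))"
      using i[OF x] i[OF AD]
      by (subst Bochner_Integration.integral_diff)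
        (auto intro!: Bochner_Integration.integral_sum Bochner_Integration.integrable_sum)
    also have "\<dots> = k x s - (\<Sum>j<length A. w j * k (A ! j) s)"
      using expectation_process_prod[OF x s] expectation_process_prod[OF AD s] by simp
    finally show ?thesis .
  qed
  show orth: "s \<in> set A \<Longrightarrow> expectation (\<lambda>\<omega>. (Y x \<omega> - krig_mean k Y A x \<omega>) * Y s \<omega>) = 0" for s
  proof -
    assume "s \<in> set A"
    then obtain l where "l < length A" "s = A ! l" by (auto simp: in_set_conv_nth)
    then show ?thesis using prod[OF AD] krig_weight_normal_equations[OF inv] by (simp add: w_def)
  qed
  have "expectation (\<lambda>\<omega>. (Y x \<omega> - krig_mean k Y A x \<omega>)\<^sup>2) =
     expectation (\<lambda>\<omega>. (Y x \<omega> - krig_mean k Y A x \<omega>) * Y x \<omega>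
        - (Y x \<omega> - krig_mean k Y A x \<omega>) * krig_mean k Y A x \<omega>)"
    by (simp add: power2_eq_square right_diff_distrib)
  also have "\<dots> = expectation (\<lambda>\<omega>. (Y x \<omega> - krig_mean k Y A x \<omega>) * Y x \<omega>)
     - expectation (\<lambda>\<omega>. (Y x \<omega> - krig_mean k Y A x \<omega>) * krig_mean k Y A x \<omega>)"
    by (rule Bochner_Integration.integral_diff) (intro lincombs_prod_integrable RD mD YD x)+
  also have "expectation (\<lambda>\<omega>. (Y x \<omega> - krig_mean k Y A x \<omega>) * krig_mean k Y A x \<omega>) = 0"
    by (rule orthogonal_lincombs[OF RD A orth krig_mean_lincomb[OF inv]])
  finally show "expectation (\<lambda>\<omega>. (Y x \<omega> - krig_mean k Y A x \<omega>)\<^sup>2) = krig_var k A x"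
    using prod[OF x] by (simp add: krig_var_eq_weights[OF inv] w_def)
qed

text \<open>Pythagoras: the error of \<open>Z\<close> is the Kriging residual plus an element of the
  span of the observations, which is orthogonal to the residual.\<close>

lemma krig_var_minimal:
  assumes inv: "invertible_mat (kmat k A A)" and A: "set A \<subseteq> D" and x: "x \<in> D"
    and Z: "Z \<in> lincombs Y (set A)"
  shows "krig_var k A x \<le> expectation (\<lambda>\<omega>. (Y x \<omega> - Z \<omega>)\<^sup>2)"
proof -
  define R where "R = (\<lambda>\<omega>. Y x \<omega> - krig_mean k Y A x \<omega>)"
  define W where "W = (\<lambda>\<omega>. krig_mean k Y A x \<omega> - Z \<omega>)"
  have W: "W \<in> lincombs Y (set A)" unfolding W_def
    by (rule lincombs_diff[OF krig_mean_lincomb[OF inv] Z])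
  have WD: "W \<in> lincombs Y D" by (rule lincombs_mono[OF W A])
  have RD: "R \<in> lincombs Y D" unfolding R_def
    by (rule lincombs_diff[OF lincombs_base[OF x] krig_mean_lincombs_D[OF inv A]])
  have "expectation (\<lambda>\<omega>. (Y x \<omega> - Z \<omega>)\<^sup>2) = expectation (\<lambda>\<omega>. (R \<omega> + W \<omega>)\<^sup>2)"
    by (simp add: R_def W_def)
  also have "\<dots> = krig_var k A x + expectation (\<lambda>\<omega>. (W \<omega>)\<^sup>2)"
    using orthogonal_lincombs[OF RD A _ W] krig_residual[OF inv A x]
    unfolding expectation_square_add[OF RD WD] by (simp add: R_def)
  finally show ?thesis by simp
qed

lemma krig_var_le_prior:
  assumes "invertible_mat (kmat k A A)" "set A \<subseteq> D" "x \<in> D"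
  shows "krig_var k A x \<le> k x x"
  using krig_var_minimal[OF assms lincombs_zero] expectation_process_prod[of x x] assms(3)
  by (simp add: power2_eq_square)

text \<open>The right-hand side is the error of predicting by the single observation at
  \<open>s\<close>; continuity of \<open>k\<close> makes it small for \<open>s\<close> close to
  \<open>x\<close>.\<close>

lemma krig_var_le_point:
  assumes "invertible_mat (kmat k A A)" "set A \<subseteq> D" "x \<in> D" "s \<in> set A"
  shows "krig_var k A x \<le> k x x - 2 * k x s + k s s"
proof -
  have s: "s \<in> D" using assms by auto
  note Y = lincombs_base[of _ D Y]
  have "expectation (\<lambda>\<omega>. (Y x \<omega> - Y s \<omega>)\<^sup>2) = expectation (\<lambda>\<omega>. Y x \<omega> * Y x \<omega> - 2 * (Y x \<omega> * Y s \<omega>) + Y s \<omega> * Y s \<omega>)"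
    by (simp add: power2_eq_square algebra_simps)
  also have "\<dots> = k x x - 2 * k x s + k s s"
    using lincombs_prod_integrable[OF Y Y] s assms(3) by (simp add: expectation_process_prod)
  finally show ?thesis using krig_var_minimal[OF assms(1-3) lincombs_base[OF assms(4)]] by simp
qed

lemma krig_var_antimono:
  assumes "invertible_mat (kmat k A A)" "invertible_mat (kmat k B B)" "set A \<subseteq> set B" "set B \<subseteq> D" "x \<in> D"
  shows "krig_var k B x \<le> krig_var k A x"
proof -
  have "krig_mean k Y A x \<in> lincombs Y (set B)"
    by (rule lincombs_mono[OF krig_mean_lincomb[OF assms(1)] assms(3)])
  from krig_var_minimal[OF assms(2,4,5) this] show ?thesis
    using krig_residual_var[OF assms(1) order_trans[OF assms(3,4)] assms(5)] by simp
qed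

end

section \<open>Consequences of the no-empty-ball property\<close>

text \<open>The NEB property speaks of infinite sequences in \<open>D\<close>;
  \<open>not_singleton\<close> ensures that there is one avoiding \<open>x\<close> even when no
  observations are given.\<close>

locale neb_gaussian_process = centered_gaussian_process M D Y k
  for M :: "'w measure" and D :: "'i::t1_space set" and Y k +
  assumes neb: "neb_property M D Y"
    and not_singleton: "x \<in> D \<Longrightarrow> \<exists>z\<in>D. z \<noteq> x"
begin

text \<open>A sequence running through the finite set \<open>S\<close> and one further point would
  have vanishing conditional variances from some index on. By NEB, \<open>x\<close> would adhere to
  a finite set, which is closed in a T1 space and does not contain \<open>x\<close>.\<close>

lemma not_perfectly_predictable:
  assumes x: "x \<in> D" and S: "finite S" "S \<subseteq> D" "x \<notin> S" and Z: "Z \<in> lincombs Y S"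
  shows "expectation (\<lambda>\<omega>. (Y x \<omega> - Z \<omega>)\<^sup>2) > 0"
proof (rule ccontr)
  assume neg: "\<not> ?thesis"
  obtain z where z: "z \<in> D" "z \<noteq> x" using not_singleton[OF x] by auto
  define T where "T = insert z S"
  have T: "finite T" "T \<subseteq> D" "x \<notin> T" "T \<noteq> {}" using S z by (auto simp: T_def)
  \<comment> \<open>The sequences of the NEB property start at index 1, hence the shift. Indices
    beyond the size of \<open>T\<close> yield some default element of \<open>T\<close>.\<close>
  define e where "e = (\<lambda>i::nat. from_nat_into T (i - 1))"
  have ran: "range (from_nat_into T) = T" using T by (simp add: countable_finite)
  have eT: "e i \<in> T" for i using ran by (auto simp: e_def)
  define h where "h t = Suc (to_nat_on T t)" for t
  have eh: "e (h t) = t" if "t \<in> T" for t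
    using that T by (simp add: e_def h_def countable_finite)
  define N where "N = Max (h ` T)"
  have sub: "T \<subseteq> e ` {1..n}" if "n \<ge> N" for n
  proof
    fix t assume t: "t \<in> T"
    have "h t \<le> N" unfolding N_def using T t by auto
    then have "h t \<in> {1..n}" using that by (auto simp: h_def)
    then show "t \<in> e ` {1..n}" using eh[OF t] by (metis image_eqI)
  qed
  have ZD: "Z \<in> lincombs Y D" by (rule lincombs_mono[OF Z S(2)])
  have RD: "(\<lambda>\<omega>. Y x \<omega> - Z \<omega>) \<in> lincombs Y D"
    by (rule lincombs_diff[OF lincombs_base[OF x] ZD])
  have "expectation (\<lambda>\<omega>. (Y x \<omega> - Z \<omega>)\<^sup>2) = 0" using neg by (simp add: antisym not_less)
  then have "AE \<omega> in M. (Y x \<omega> - Z \<omega>)\<^sup>2 = 0"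
    using integral_nonneg_eq_0_iff_AE[OF lincombs_square_integrable[OF RD]] by simp
  then have R0: "AE \<omega> in M. Y x \<omega> - Z \<omega> = 0" by simp
  have "AE \<omega> in M. cond_var M (generated_by M {1..n} (\<lambda>i. Y (e i))) (Y x) \<omega> = 0" if n: "n \<ge> N" for n
  proof -
    have "AE \<omega> in M. cond_var M (generated_by M {1..n} (\<lambda>i. Y (e i))) (Y x) \<omega> =
        expectation (\<lambda>\<omega>. (Y x \<omega> - Z \<omega>)\<^sup>2)"
    proof (rule cond_var_residual)
      show "Z \<in> lincombs Y (e ` {1..n})"
        by (rule lincombs_mono[OF Z]) (use sub[OF n] in \<open>auto simp: T_def\<close>)
      fix i assume "i \<in> {1..n}"
      have [measurable]: "Y (e i) \<in> borel_measurable M" "(\<lambda>\<omega>. Y x \<omega> - Z \<omega>) \<in> borel_measurable M"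
        using measurable_process[OF subsetD[OF T(2) eT]] RD by auto
      \<comment> \<open>The residual is zero almost surely, hence orthogonal to every
        observation.\<close>
      have "expectation (\<lambda>\<omega>. (Y x \<omega> - Z \<omega>) * Y (e i) \<omega>) = expectation (\<lambda>\<omega>. 0)"
        by (rule integral_cong_AE) (use R0 in auto)
      then show "expectation (\<lambda>\<omega>. (Y x \<omega> - Z \<omega>) * Y (e i) \<omega>) = 0" by simp
    qed (use eT T x in auto)
    then show ?thesis using \<open>expectation (\<lambda>\<omega>. (Y x \<omega> - Z \<omega>)\<^sup>2) = 0\<close> by simp
  qed
  then have "AE \<omega> in M. \<forall>n\<in>{N..}. cond_var M (generated_by M {1..n} (\<lambda>i. Y (e i))) (Y x) \<omega> = 0"
    by (subst AE_ball_countable) auto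
  then have "AE \<omega> in M. (\<lambda>n. cond_var M (generated_by M {1..n} (\<lambda>i. Y (e i))) (Y x) \<omega>) \<longlonglongrightarrow> 0"
  proof eventually_elim
    case (elim \<omega>)
    then show ?case
      by (intro tendsto_eventually) (auto simp: eventually_sequentially)
  qed
  moreover have "\<forall>i\<ge>1. e i \<in> D" using eT T by auto
  ultimately have "x \<in> closure (e ` {1..})"
    using neb x unfolding neb_property_def by blast
  also have "\<dots> \<subseteq> closure T" using eT by (intro closure_mono) auto
  also have "\<dots> = T" using T by (simp add: finite_imp_closed)
  finally show False using T by simp
qed

text \<open>A kernel vector of the covariance matrix yields a combination \<open>U\<close> of the
  observations with zero second moment. Solving \<open>U\<close> = 0 for an observation with
  non-zero coefficient predicts it perfectly from the others, contradicting NEB.\<close>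

lemma invertible_kmat:
  assumes A: "distinct A" "set A \<subseteq> D"
  shows "invertible_mat (kmat k A A)"
proof (rule ccontr)
  define n where "n = length A"
  have K: "kmat k A A \<in> carrier_mat n n" by (simp add: kmat_def n_def)
  assume "\<not> invertible_mat (kmat k A A)"
  then have "Determinant.det (kmat k A A) = 0"
    using det_non_zero_imp_unit[OF K, where b = "()"] invertible_mat_iff_Units[OF K] by blast
  then obtain v where v: "v \<in> carrier_vec n" "v \<noteq> 0\<^sub>v n" "kmat k A A *\<^sub>v v = 0\<^sub>v n"
    using det_0_iff_vec_prod_zero_field[OF K] by blast
  have Kv: "(\<Sum>j<n. k (A ! i) (A ! j) * v $ j) = 0" if "i < n" for i
  proof -
    have "(kmat k A A *\<^sub>v v) $ i = (\<Sum>j<n. k (A ! i) (A ! j) * v $ j)"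
      using that v(1) by (auto simp: kmat_def n_def scalar_prod_def atLeast0LessThan intro!: sum.cong)
    then show ?thesis using v(3) that by simp
  qed
  obtain j where j: "j < n" "v $ j \<noteq> 0" using v by (metis eq_vecI carrier_vecD index_zero_vec)
  have AD: "A ! i \<in> D" if "i < n" for i using that A nth_mem unfolding n_def by blast
  define U where "U = (\<lambda>\<omega>. \<Sum>i<n. v $ i * Y (A ! i) \<omega>)"
  have UD: "U \<in> lincombs Y D" unfolding U_def
    using AD by (auto intro!: lincombs_sum_closed lincombs_scale lincombs_base)
  have UY: "expectation (\<lambda>\<omega>. U \<omega> * Y (A ! l) \<omega>) = 0" if l: "l < n" for l
  proof -
    have "(\<lambda>\<omega>. U \<omega> * Y (A ! l) \<omega>) = (\<lambda>\<omega>. \<Sum>i<n. v $ i * (Y (A ! l) \<omega> * Y (A ! i) \<omega>))"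
      unfolding U_def sum_distrib_right by (intro ext sum.cong) (auto simp: mult_ac)
    moreover have "integrable M (\<lambda>\<omega>. Y (A ! l) \<omega> * Y (A ! i) \<omega>)" if "i < n" for i
      using AD that l by (intro lincombs_prod_integrable lincombs_base) auto
    ultimately show ?thesis using Kv[OF l] AD l covariance_sym[OF AD AD[OF l]]
      by (simp add: Bochner_Integration.integral_sum expectation_process_prod mult.commute)
  qed
  define Z where "Z = (\<lambda>\<omega>. \<Sum>i\<in>{..<n} - {j}. (- v $ i / v $ j) * Y (A ! i) \<omega>)"
  have Z: "Z \<in> lincombs Y (set A - {A ! j})"
    unfolding Z_def
  proof (intro lincombs_sum_closed lincombs_scale lincombs_base)
    fix i assume "i \<in> {..<n} - {j}"
    then show "A ! i \<in> set A - {A ! j}" using A(1) j(1) by (auto simp: n_def nth_eq_iff_index_eq)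
  qed
  have "Y (A ! j) \<omega> - Z \<omega> = (1 / v $ j) * U \<omega>" for \<omega>
  proof -
    have "U \<omega> = v $ j * Y (A ! j) \<omega> + (\<Sum>i\<in>{..<n} - {j}. v $ i * Y (A ! i) \<omega>)"
      unfolding U_def using j(1) by (subst sum.remove[of _ j]) auto
    moreover have "v $ j * Z \<omega> = - (\<Sum>i\<in>{..<n} - {j}. v $ i * Y (A ! i) \<omega>)"
      unfolding Z_def sum_distrib_left sum_negf[symmetric] using j(2) by (intro sum.cong) auto
    ultimately show ?thesis using j(2) by (simp add: field_simps)
  qed
  then have "expectation (\<lambda>\<omega>. (Y (A ! j) \<omega> - Z \<omega>)\<^sup>2) = expectation (\<lambda>\<omega>. (1 / v $ j)\<^sup>2 * (U \<omega> * U \<omega>))"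
    by (simp add: power_mult_distrib power2_eq_square)
  also have "\<dots> = (1 / v $ j)\<^sup>2 * expectation (\<lambda>\<omega>. U \<omega> * U \<omega>)" by simp
  also have "expectation (\<lambda>\<omega>. U \<omega> * U \<omega>) = 0"
  proof (rule orthogonal_lincombs[OF UD A(2)])
    show "U \<in> lincombs Y (set A)" unfolding U_def n_def
      by (auto intro!: lincombs_sum_closed lincombs_scale lincombs_base)
  qed (use UY in \<open>auto simp: in_set_conv_nth n_def\<close>)
  finally have "expectation (\<lambda>\<omega>. (Y (A ! j) \<omega> - Z \<omega>)\<^sup>2) = 0" by simp
  moreover have "expectation (\<lambda>\<omega>. (Y (A ! j) \<omega> - Z \<omega>)\<^sup>2) > 0"
    by (rule not_perfectly_predictable[OF AD[OF j(1)] _ _ _ Z]) (use A in auto)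
  ultimately show False by simp
qed

lemma krig_var_pos:
  assumes "distinct A" "set A \<subseteq> D" "x \<in> D" "x \<notin> set A"
  shows "krig_var k A x > 0"
proof -
  have inv: "invertible_mat (kmat k A A)" using assms by (intro invertible_kmat)
  show ?thesis
    using not_perfectly_predictable[OF assms(3) _ assms(2,4) krig_mean_lincomb[OF inv, of x]]
      krig_residual_var[OF inv assms(2,3)] by simp
qed

text \<open>The variances decrease with \<open>n\<close>, so without a positive lower bound they
  tend to zero, and NEB would put \<open>x\<close> in the closure. The constant depends on
  \<open>x\<close>; uniformity is obtained later by a measure argument.\<close>

lemma krig_var_bounded_below:
  assumes g: "inj g" "range g \<subseteq> D" and x: "x \<in> D" "x \<notin> closure (range g)"
  shows "\<exists>c>0. \<forall>n. krig_var k (map g [0..<n]) x \<ge> c"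
proof (rule ccontr)
  let ?A = "\<lambda>n. map g [0..<n]"
  let ?V = "\<lambda>n. krig_var k (?A n) x"
  assume neg: "\<not> ?thesis"
  have dA: "distinct (?A n)" "set (?A n) \<subseteq> D" for n
    using g by (auto simp: distinct_map inj_on_def)
  have inv: "invertible_mat (kmat k (?A n) (?A n))" for n using dA by (rule invertible_kmat)
  have pos: "?V n > 0" for n
    by (rule krig_var_pos[OF dA x(1)]) (use x(2) closure_subset[of "range g"] in auto)
  have mono: "?V n \<le> ?V m" if "m \<le> n" for m n
    by (rule krig_var_antimono[OF inv inv _ dA(2) x(1)]) (use that in auto)
  have "?V \<longlonglongrightarrow> 0"
  proof (rule LIMSEQ_I)
    fix r :: real assume "r > 0"
    then obtain m where "?V m < r" using neg by (auto simp: not_le)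
    then have "\<forall>n\<ge>m. norm (?V n - 0) < r" using mono pos by (auto simp: less_imp_le intro: le_less_trans)
    then show "\<exists>no. \<forall>n\<ge>no. norm (?V n - 0) < r" by blast
  qed
  \<comment> \<open>Shifts \<open>g\<close>, which is indexed from 0, to the index range of the NEB
    property.\<close>
  define e where "e = (\<lambda>i::nat. g (i - 1))"
  have img: "e ` {1..n} = set (?A n)" for n
  proof -
    have "{1..n} = Suc ` {0..<n}"
      by (simp add: image_Suc_atLeastLessThan atLeastLessThanSuc_atLeastAtMost)
    then show ?thesis by (simp only: image_image e_def) simp
  qed
  have "AE \<omega> in M. cond_var M (generated_by M {1..n} (\<lambda>i. Y (e i))) (Y x) \<omega> = ?V n" for n
  proof -
    have "AE \<omega> in M. cond_var M (generated_by M {1..n} (\<lambda>i. Y (e i))) (Y x) \<omega> =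
        expectation (\<lambda>\<omega>. (Y x \<omega> - krig_mean k Y (?A n) x \<omega>)\<^sup>2)"
    proof (rule cond_var_residual)
      show "krig_mean k Y (?A n) x \<in> lincombs Y (e ` {1..n})"
        unfolding img by (rule krig_mean_lincomb[OF inv])
      fix i assume "i \<in> {1..n}"
      then have "e i \<in> set (?A n)" using img[of n] by blast
      then show "expectation (\<lambda>\<omega>. (Y x \<omega> - krig_mean k Y (?A n) x \<omega>) * Y (e i) \<omega>) = 0"
        by (rule krig_residual_orthogonal[OF inv dA(2) x(1)])
    qed (use g x in \<open>auto simp: e_def\<close>)
    then show ?thesis using krig_residual_var[OF inv dA(2) x(1)] by simp
  qed
  then have "AE \<omega> in M. \<forall>n. cond_var M (generated_by M {1..n} (\<lambda>i. Y (e i))) (Y x) \<omega> = ?V n"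
    by (subst AE_all_countable) auto
  then have "AE \<omega> in M. (\<lambda>n. cond_var M (generated_by M {1..n} (\<lambda>i. Y (e i))) (Y x) \<omega>) \<longlonglongrightarrow> 0"
    by eventually_elim (use \<open>?V \<longlonglongrightarrow> 0\<close> in simp)
  moreover have "\<forall>i\<ge>1. e i \<in> D" using g by (auto simp: e_def)
  ultimately have "x \<in> closure (e ` {1..})"
    using neb x unfolding neb_property_def by blast
  also have "\<dots> \<subseteq> closure (range g)" by (intro closure_mono) (auto simp: e_def)
  finally show False using x by simp
qed

end

section \<open>The design\<close>

text \<open>The error equals \<open>1 - w\<close> times the error of predicting by B / (1 - w), plus
  \<open>w\<close> times the error of \<open>U\<close>. The first part has second moment at least (1
  - w)^2 c by \<open>far\<close>, the second at most w^2 c / 8.\<close>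

lemma (in centered_gaussian_process) mse_lower_bound:
  assumes x: "x \<in> D" and T: "T \<subseteq> D" and U: "U \<in> lincombs Y D" and B: "B \<in> lincombs Y T"
    and far: "\<And>Z. Z \<in> lincombs Y T \<Longrightarrow> c \<le> expectation (\<lambda>\<omega>. (Y x \<omega> - Z \<omega>)\<^sup>2)"
    and near: "expectation (\<lambda>\<omega>. (Y x \<omega> - U \<omega>)\<^sup>2) \<le> c / 8" and w: "w \<le> 1 / 2" and c: "0 \<le> c"
  shows "c / 16 \<le> expectation (\<lambda>\<omega>. (Y x \<omega> - (w * U \<omega> + B \<omega>))\<^sup>2)"
proof -
  define e where "e = expectation (\<lambda>\<omega>. (Y x \<omega> - (w * U \<omega> + B \<omega>))\<^sup>2)"
  define f where "f = expectation (\<lambda>\<omega>. (Y x \<omega> - U \<omega>)\<^sup>2)"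
  have BD: "B \<in> lincombs Y D" by (rule lincombs_mono[OF B T])
  have YD: "Y x \<in> lincombs Y D" using x by (rule lincombs_base)
  note closed = lincombs_diff lincombs_add lincombs_scale YD BD U
  have i1: "integrable M (\<lambda>\<omega>. (Y x \<omega> - (w * U \<omega> + B \<omega>))\<^sup>2)"
    by (intro lincombs_square_integrable closed)
  have i2: "integrable M (\<lambda>\<omega>. (Y x \<omega> - U \<omega>)\<^sup>2)"
    by (intro lincombs_square_integrable closed)
  have i3: "integrable M (\<lambda>\<omega>. (Y x \<omega> - (1 / (1 - w)) * B \<omega>)\<^sup>2)"
    by (intro lincombs_square_integrable closed)
  have "(1 - w)\<^sup>2 * c \<le> (1 - w)\<^sup>2 * expectation (\<lambda>\<omega>. (Y x \<omega> - (1 / (1 - w)) * B \<omega>)\<^sup>2)"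
    by (intro mult_left_mono far lincombs_scale B) auto
  also have "\<dots> = expectation (\<lambda>\<omega>. (1 - w)\<^sup>2 * (Y x \<omega> - (1 / (1 - w)) * B \<omega>)\<^sup>2)" by simp
  also have "\<dots> \<le> expectation (\<lambda>\<omega>. 2 * (Y x \<omega> - (w * U \<omega> + B \<omega>))\<^sup>2 + 2 * w\<^sup>2 * (Y x \<omega> - U \<omega>)\<^sup>2)"
  proof (rule integral_mono)
    fix \<omega>
    define s where "s = Y x \<omega> - (w * U \<omega> + B \<omega>)"
    define t where "t = w * (Y x \<omega> - U \<omega>)"
    have "(1 - w) * (Y x \<omega> - (1 / (1 - w)) * B \<omega>) = s - t"
      using w by (simp add: s_def t_def field_simps)
    then have "(1 - w)\<^sup>2 * (Y x \<omega> - (1 / (1 - w)) * B \<omega>)\<^sup>2 = (s - t)\<^sup>2"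
      by (metis power_mult_distrib)
    also have "\<dots> \<le> 2 * s\<^sup>2 + 2 * t\<^sup>2"
      using zero_le_power2[of "s + t"] by (simp add: power2_sum power2_diff)
    finally show "(1 - w)\<^sup>2 * (Y x \<omega> - (1 / (1 - w)) * B \<omega>)\<^sup>2
        \<le> 2 * (Y x \<omega> - (w * U \<omega> + B \<omega>))\<^sup>2 + 2 * w\<^sup>2 * (Y x \<omega> - U \<omega>)\<^sup>2"
      by (simp add: s_def t_def power_mult_distrib mult.assoc)
  qed (use i1 i2 i3 in auto)
  also have "\<dots> = 2 * e + 2 * w\<^sup>2 * f" using i1 i2 by (simp add: e_def f_def)
  also have "\<dots> \<le> 2 * e + 2 * w\<^sup>2 * (c / 8)"
    using near unfolding f_def by (intro add_left_mono mult_left_mono) auto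
  also have "\<dots> \<le> 2 * e + 2 * (1 - w)\<^sup>2 * (c / 8)"
  proof -
    \<comment> \<open>Very negative \<open>w\<close> are allowed: \<open>w\<close> at most 1/2
      already gives |w| at most 1 - w.\<close>
    have "w\<^sup>2 \<le> (1 - w)\<^sup>2" using w by (intro power2_le_iff_abs_le[THEN iffD2]) auto
    then show ?thesis using c by (intro add_left_mono mult_right_mono) auto
  qed
  finally have 1: "3 / 8 * ((1 - w)\<^sup>2 * c) \<le> e" by (simp add: field_simps)
  have "(1 / 2)\<^sup>2 \<le> (1 - w)\<^sup>2" using w by (intro power_mono) auto
  then have "1 / 4 * c \<le> (1 - w)\<^sup>2 * c" using c by (intro mult_right_mono) (auto simp: power2_eq_square)
  with 1 c have "c / 16 \<le> e" by linarith
  then show ?thesis by (simp add: e_def)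
qed

text \<open>With positive covariance the only Kriging weight is positive, so the observation
  strictly reduces the variance. This places the arguments of a one-point block in
  \<open>Delta_int\<close>, where \<open>b\<close> is positive.\<close>

lemma (in neb_gaussian_process) krig_var_singleton_less_prior:
  assumes "x \<in> D" "y \<in> D" "k x y > 0"
  shows "krig_var k [y] x < k x x"
proof -
  have inv: "invertible_mat (kmat k [y] [y])" using assms by (intro invertible_kmat) auto
  have "krig_weight k [y] x 0 * k y y = k x y"
    using krig_weight_normal_equations[OF inv, of 0 x] by simp
  moreover have "0 \<le> k y y"
    using expectation_process_prod[of y y] assms Bochner_Integration.integral_nonneg[of M "\<lambda>\<omega>. Y y \<omega> * Y y \<omega>"] by simp
  ultimately have "krig_weight k [y] x 0 > 0"
    using assms(3) by (metis mult_nonpos_nonneg not_le)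
  then show ?thesis
    using krig_var_eq_weights[OF inv, of x] assms covariance_sym[of y x] by simp
qed

section \<open>Auxiliary facts from topology and measure theory\<close>

text \<open>A countable dense subset is infinite, since a finite one would be closed and contain
  \<open>D\<close>; finite subcovers make the density uniform. Injectivity keeps the covariance
  matrices of initial segments invertible.\<close>

lemma compact_dense_sequence:
  fixes D :: "'a::euclidean_space set"
  assumes "compact D" "infinite D"
  obtains q :: "nat \<Rightarrow> 'a" where "inj q" "range q \<subseteq> D"
    "\<And>e. e > 0 \<Longrightarrow> \<exists>m. \<forall>z\<in>D. \<exists>i<m. dist (q i) z < e"
proof -
  obtain T where T: "countable T" "T \<subseteq> D" "D \<subseteq> closure T" using separable by blast
  have "infinite T" using T assms finite_imp_closed[of T] infinite_super[of D T] by (auto simp: closure_closed)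
  define q where "q = from_nat_into T"
  have bij: "bij_betw q UNIV T" unfolding q_def by (rule bij_betw_from_nat_into) fact+
  show ?thesis
  proof (rule that)
    show "inj q" "range q \<subseteq> D" using bij T by (auto simp: bij_betw_def)
    fix e :: real assume e: "e > 0"
    have "D \<subseteq> (\<Union>i\<in>UNIV. ball (q i) e)"
    proof
      fix z assume "z \<in> D"
      then obtain y where "y \<in> T" "dist y z < e" using T(3) e by (auto simp: closure_approachable subset_iff)
      moreover obtain i where "y = q i" using bij \<open>y \<in> T\<close> by (auto simp: bij_betw_def)
      ultimately show "z \<in> (\<Union>i\<in>UNIV. ball (q i) e)" by auto
    qed
    then obtain J where J: "finite J" "D \<subseteq> (\<Union>i\<in>J. ball (q i) e)"
      using compactE_image[OF assms(1), of UNIV "\<lambda>i. ball (q i) e"] by auto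
    show "\<exists>m. \<forall>z\<in>D. \<exists>i<m. dist (q i) z < e"
    proof (rule exI[of _ "Suc (Max J)"], rule ballI)
      fix z assume "z \<in> D"
      then obtain i where "i \<in> J" "dist (q i) z < e" using J by auto
      then show "\<exists>i<Suc (Max J). dist (q i) z < e" using J(1) by (intro exI[of _ i]) (auto simp: less_Suc_eq_le)
    qed
  qed
qed

text \<open>Inner approximation by a closed set, with a loss smaller than some positive real
  \<open>e\<close> below the measure of \<open>S\<close>; \<open>e\<close> is introduced because
  that measure may be infinite.\<close>

lemma lebesgue_inner_closed_pos:
  fixes S :: "'a::euclidean_space set"
  assumes "S \<in> sets lebesgue" "emeasure lebesgue S > 0"
  obtains T where "closed T" "T \<subseteq> S" "emeasure lebesgue T > 0"
proof -
  have "\<exists>e::real. e > 0 \<and> ennreal e \<le> emeasure lebesgue S"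
  proof (cases "emeasure lebesgue S")
    case (real r)
    then show ?thesis using assms(2) by (intro exI[of _ r]) (auto simp: less_le)
  next
    case top
    then show ?thesis by (intro exI[of _ 1]) simp
  qed
  then obtain e :: real where e: "e > 0" "ennreal e \<le> emeasure lebesgue S" by blast
  obtain T where T: "closed T" "T \<subseteq> S" "S - T \<in> lmeasurable" "emeasure lebesgue (S - T) < ennreal e"
    using sets_lebesgue_inner_closed[OF assms(1) e(1)] by blast
  have "emeasure lebesgue S \<le> emeasure lebesgue T + emeasure lebesgue (S - T)"
    using emeasure_subadditive[of T lebesgue "S - T"] T assms(1) by (simp add: Un_absorb1)
  then have "emeasure lebesgue T \<noteq> 0" using T(4) e(2) by auto
  then show ?thesis using that T by (simp add: zero_less_iff_neq_zero)
qed

text \<open>\<open>m n\<close> is the largest admissible index, and 0 when no positive index is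
  admissible; this default explains the guard in the last conclusion. Each fixed index becomes
  admissible once \<open>s n\<close> is large.\<close>

lemma slow_subsequence:
  fixes s :: "nat \<Rightarrow> nat" and F :: "nat \<Rightarrow> real"
  assumes s: "filterlim s at_top sequentially"
  obtains m where "filterlim m at_top sequentially" "\<And>n. m n \<le> s n"
    "\<And>n. 1 \<le> m n \<Longrightarrow> F (m n) \<le> real (s n)"
proof -
  define A where "A n = {i. i \<le> s n \<and> F i \<le> real (s n)}" for n
  define m where "m n = Max (insert 0 (A n))" for n
  have fin: "finite (insert 0 (A n))" for n unfolding A_def by auto
  have mem: "m n \<in> insert 0 (A n)" for n unfolding m_def using fin by (rule Max_in) auto
  show ?thesis
  proof (rule that)
    show "filterlim m at_top sequentially"
      unfolding filterlim_at_top
    proof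
      fix N
      have "\<forall>\<^sub>F n in sequentially. max N (nat \<lceil>F N\<rceil>) \<le> s n" using s unfolding filterlim_at_top by blast
      then show "\<forall>\<^sub>F n in sequentially. N \<le> m n"
      proof eventually_elim
        case (elim n)
        then have "F N \<le> real (s n)" by linarith
        then have "N \<in> insert 0 (A n)" using elim by (auto simp: A_def)
        then show ?case unfolding m_def using fin by (intro Max_ge)
      qed
    qed
    show "m n \<le> s n" for n using mem[of n] by (auto simp: A_def)
    show "F (m n) \<le> real (s n)" if "1 \<le> m n" for n using mem[of n] that by (auto simp: A_def)
  qed
qed

text \<open>\<open>m\<close> points of the dense sequence \<open>q\<close> form the first block. All other observations come from the
  sequence \<open>g\<close>: the second block takes up the bulk of the \<open>n\<close> rows, and \<open>s\<close> one-point blocks, all at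
  \<open>g 0\<close>, inflate the denominator of the weight bound.\<close>

definition design_pts :: "(nat \<Rightarrow> 'a) \<Rightarrow> (nat \<Rightarrow> 'a) \<Rightarrow> nat \<Rightarrow> nat \<Rightarrow> nat \<Rightarrow> nat \<Rightarrow> 'a" where
  "design_pts q g m s n i =
     (if i \<le> m then q (i - 1) else if i \<le> n - s then g (i - m - 1) else g 0)"

definition design_blocks :: "nat \<Rightarrow> nat \<Rightarrow> nat \<Rightarrow> nat \<Rightarrow> nat set" where
  "design_blocks m s n l =
     (if l = 1 then {1..m} else if l = 2 then {m + 1..n - s} else {n - s + (l - 2)})"

section \<open>Blocks of the design and continuity of the covariance\<close>

lemma submat_design:
  assumes "m + s < n"
  shows "submat (design_pts q g m s n) (design_blocks m s n 1) = map q [0..<m]"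
    and "submat (design_pts q g m s n) (design_blocks m s n 2) = map g [0..<n - s - m]"
    and "3 \<le> l \<Longrightarrow> submat (design_pts q g m s n) (design_blocks m s n l) = [g 0]"
proof -
  have sl: "sorted_list_of_set {a + 1..b} = [Suc a..<Suc b]" for a b :: nat
    using sorted_list_of_set_range[of "Suc a" "Suc b"] by (simp add: atLeastLessThanSuc_atLeastAtMost)
  show "submat (design_pts q g m s n) (design_blocks m s n 1) = map q [0..<m]"
    using sl[of 0 m] unfolding submat_def design_blocks_def
    by (auto simp: design_pts_def intro!: nth_equalityI simp del: upt_Suc)
  show "submat (design_pts q g m s n) (design_blocks m s n 2) = map g [0..<n - s - m]"
    using sl[of m "n - s"] assms unfolding submat_def design_blocks_def
    by (auto simp: design_pts_def intro!: nth_equalityI simp del: upt_Suc)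
  show "submat (design_pts q g m s n) (design_blocks m s n l) = [g 0]" if "3 \<le> l"
    using that assms unfolding submat_def design_blocks_def by (auto simp: design_pts_def)
qed

lemma row_partition_design:
  assumes "1 \<le> m" "m + s < n"
  shows "row_partition n (s + 2) (design_blocks m s n)"
  unfolding row_partition_def
proof (intro conjI ballI)
  fix l assume "l \<in> {1..s + 2}"
  then show "design_blocks m s n l \<noteq> {}" "design_blocks m s n l \<subseteq> {1..n}"
    using assms by (auto simp: design_blocks_def)
next
  fix i assume i: "i \<in> {1..n}"
  \<comment> \<open>The one-point blocks 3 to \<open>s + 2\<close> cover the last \<open>s\<close>
    rows in order.\<close>
  define l where "l = (if i \<le> m then 1 else if i \<le> n - s then 2 else i - (n - s) + 2)"
  show "\<exists>!l. l \<in> {1..s + 2} \<and> i \<in> design_blocks m s n l"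
  proof (rule ex1I[of _ l])
    show "l \<in> {1..s + 2} \<and> i \<in> design_blocks m s n l"
      using i assms by (auto simp: l_def design_blocks_def)
    show "l' = l" if "l' \<in> {1..s + 2} \<and> i \<in> design_blocks m s n l'" for l'
      using that i assms by (auto simp: l_def design_blocks_def split: if_splits)
  qed
qed

text \<open>One ball is for prediction points, the other for observations. They are closed so that
  limits of observations also stay away from the prediction points.\<close>

lemma positive_cballs:
  fixes k :: "'a::euclidean_space \<Rightarrow> 'a \<Rightarrow> real"
  assumes k: "continuous_on UNIV (\<lambda>(x, y). k x y)"
    and xy: "x \<in> interior D" "y \<in> interior D" "x \<noteq> y" "k x y > 0"
  obtains r where "r > 0" "cball x r \<subseteq> D" "cball y r \<subseteq> D" "cball x r \<inter> cball y r = {}"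
    "\<forall>u\<in>cball x r. \<forall>v\<in>cball y r. k u v > 0"
proof -
  define G where "G = {p. 0 < (case p of (x, y) \<Rightarrow> k x y)}"
  have "open G" unfolding G_def by (intro open_Collect_less continuous_on_const k)
  moreover have "(x, y) \<in> G" using xy by (simp add: G_def)
  ultimately obtain A B where AB: "open A" "open B" "x \<in> A" "y \<in> B" "A \<times> B \<subseteq> G"
    by (rule open_prod_elim) auto
  obtain U V where UV: "open U" "open V" "x \<in> U" "y \<in> V" "U \<inter> V = {}"
    using hausdorff[OF xy(3)] by blast
  have "open (A \<inter> U \<inter> interior D)" "open (B \<inter> V \<inter> interior D)"
    using AB UV by auto
  then obtain r1 r2 where r: "r1 > 0" "cball x r1 \<subseteq> A \<inter> U \<inter> interior D"
      "r2 > 0" "cball y r2 \<subseteq> B \<inter> V \<inter> interior D"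
    using AB UV xy by (metis IntI open_contains_cball)
  have sub: "cball x (min r1 r2) \<subseteq> A \<inter> U \<inter> interior D" "cball y (min r1 r2) \<subseteq> B \<inter> V \<inter> interior D"
    using r by (auto simp: subset_iff)
  show ?thesis
  proof (rule that[of "min r1 r2"])
    show "cball x (min r1 r2) \<subseteq> D" "cball y (min r1 r2) \<subseteq> D" using sub interior_subset by blast+
    show "cball x (min r1 r2) \<inter> cball y (min r1 r2) = {}" using sub UV by blast
    show "\<forall>u\<in>cball x (min r1 r2). \<forall>v\<in>cball y (min r1 r2). k u v > 0"
    proof (intro ballI)
      fix u v assume "u \<in> cball x (min r1 r2)" "v \<in> cball y (min r1 r2)"
      then have "(u, v) \<in> A \<times> B" using sub by blast
      then show "k u v > 0" using AB(5) by (auto simp: G_def)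
    qed
  qed (use r in auto)
qed

text \<open>The increment vanishes on the diagonal and is uniformly continuous on the compact
  square, so comparing (z, s) with (z, z) bounds it.\<close>

lemma uniformly_small_increment:
  fixes k :: "'a::euclidean_space \<Rightarrow> 'a \<Rightarrow> real"
  assumes k: "continuous_on UNIV (\<lambda>(x, y). k x y)" and D: "compact D" and e: "e > 0"
  obtains d where "d > 0" "\<And>z s. z \<in> D \<Longrightarrow> s \<in> D \<Longrightarrow> dist s z < d \<Longrightarrow> k z z - 2 * k z s + k s s < e"
proof -
  define h where "h = (\<lambda>p. k (fst p) (fst p) - 2 * k (fst p) (snd p) + k (snd p) (snd p))"
  have c: "continuous_on S (\<lambda>x. k (f x) (h x))" if "continuous_on S f" "continuous_on S h" for f h and S :: "('a \<times> 'a) set"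
    using continuous_on_compose2[OF k continuous_on_Pair[OF that]] by simp
  have "continuous_on (D \<times> D) h" unfolding h_def
    by (intro continuous_on_add continuous_on_diff continuous_on_mult continuous_on_const
        c continuous_on_fst continuous_on_snd continuous_on_id)
  then have uc: "uniformly_continuous_on (D \<times> D) h"
    by (rule compact_uniformly_continuous) (intro compact_Times D)
  obtain d where d: "d > 0"
      "\<And>p p'. p \<in> D \<times> D \<Longrightarrow> p' \<in> D \<times> D \<Longrightarrow> dist p' p < d \<Longrightarrow> dist (h p') (h p) < e"
    using uniformly_continuous_onE[OF uc e] by metis
  show ?thesis
  proof (rule that[OF d(1)])
    fix z s assume zs: "z \<in> D" "s \<in> D" "dist s z < d"
    have "dist (h (z, s)) (h (z, z)) < e"
      using zs by (intro d(2)) (auto simp: dist_Pair_Pair)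
    then show "k z z - 2 * k z s + k s s < e" by (simp add: h_def dist_real_def)
  qed
qed

section \<open>Error of the aggregated predictor on a compact set\<close>

text \<open>\<open>C\<close> is the set of prediction points and \<open>c\<close> bounds the
  prediction variance from \<open>g\<close> uniformly in the point and in the number of
  observations. As \<open>C\<close> avoids both sequences, the variances stay positive and the
  weight bound applies.\<close>

locale kriging_counterexample = neb_gaussian_process M D Y k
  for M :: "'w measure" and D :: "(real ^ 'd) set" and Y k +
  fixes \<alpha> :: "nat \<Rightarrow> nat \<Rightarrow> real list \<Rightarrow> real" and a b :: "real \<times> real \<Rightarrow> real"
    and q g :: "nat \<Rightarrow> real ^ 'd" and C :: "(real ^ 'd) set" and c :: real
  assumes compact_D: "compact D"
    and k_cont: "continuous_on UNIV (\<lambda>(x, y). k x y)"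
    and a_cont: "continuous_on Delta a" and b_cont: "continuous_on Delta b"
    and b_nonneg: "\<forall>z\<in>Delta. 0 \<le> b z" and b_pos: "\<forall>z\<in>Delta_int. 0 < b z"
    and a_nonneg: "\<forall>z\<in>Delta. 0 \<le> a z"
    and weights: "weights_bounded D k \<alpha> a b"
    and q: "inj q" "range q \<subseteq> D" "\<And>e. e > 0 \<Longrightarrow> \<exists>m. \<forall>z\<in>D. \<exists>i<m. dist (q i) z < e"
    and g: "inj g" "range g \<subseteq> D"
    and C: "compact C" "C \<subseteq> D" "C \<inter> range q = {}" "C \<inter> range g = {}"
    and pos: "\<And>z. z \<in> C \<Longrightarrow> k z (g 0) > 0"
    and c: "c > 0" "\<And>z n. z \<in> C \<Longrightarrow> c \<le> krig_var k (map g [0..<n]) z"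
begin

lemma design_lists:
  shows "distinct (map q [0..<m])" "set (map q [0..<m]) \<subseteq> D"
    and "distinct (map g [0..<m])" "set (map g [0..<m]) \<subseteq> D"
    and "distinct [g 0]" "set [g 0] \<subseteq> D"
  using q g by (auto simp: distinct_map inj_on_def)

lemma design_lists_invertible:
  "invertible_mat (kmat k (map q [0..<m]) (map q [0..<m]))"
  "invertible_mat (kmat k (map g [0..<m]) (map g [0..<m]))"
  "invertible_mat (kmat k [g 0] [g 0])"
  by (intro invertible_kmat design_lists)+

lemma krig_var_in_Delta:
  assumes "distinct A" "set A \<subseteq> D" "z \<in> D" "z \<notin> set A"
  shows "(krig_var k A z, k z z) \<in> Delta"
  using krig_var_pos[OF assms] krig_var_le_prior[OF invertible_kmat[OF assms(1,2)] assms(2,3)]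
  by (auto simp: Delta_def)

lemma in_Delta:
  assumes "z \<in> C"
  shows "(krig_var k (map q [0..<m]) z, k z z) \<in> Delta"
    and "(krig_var k (map g [0..<m]) z, k z z) \<in> Delta"
    and "(krig_var k [g 0] z, k z z) \<in> Delta_int"
proof -
  have z: "z \<in> D" "z \<notin> set (map q [0..<m])" "z \<notin> set (map g [0..<m])" "z \<notin> set [g 0]"
    using assms C by auto
  show "(krig_var k (map q [0..<m]) z, k z z) \<in> Delta" "(krig_var k (map g [0..<m]) z, k z z) \<in> Delta"
    by (intro krig_var_in_Delta design_lists z)+
  show "(krig_var k [g 0] z, k z z) \<in> Delta_int"
    using krig_var_in_Delta[OF design_lists(5,6) z(1,4)] krig_var_singleton_less_prior[OF z(1) _ pos[OF assms]]
      design_lists(6)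
    by (auto simp: Delta_def Delta_int_def)
qed

text \<open>A continuous function on the compact set \<open>C\<close>. Divided by the number of
  one-point blocks, this ratio bounds the weight of the first block; the bound depends on
  \<open>m\<close>, hence the slow growth of \<open>m\<close>.\<close>

lemma ratio_bounded:
  "\<exists>B. \<forall>z\<in>C. a (krig_var k (map q [0..<m]) z, k z z) / b (krig_var k [g 0] z, k z z) \<le> B"
proof -
  have kzz: "continuous_on C (\<lambda>z. k z z)"
    using continuous_on_compose2[OF k_cont continuous_on_Pair[OF continuous_on_id continuous_on_id], of C] by simp
  have sub: "Delta_int \<subseteq> Delta" by (auto simp: Delta_int_def Delta_def)
  have "continuous_on C (\<lambda>z. a (krig_var k (map q [0..<m]) z, k z z) / b (krig_var k [g 0] z, k z z))"
  proof (intro continuous_on_divide)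
    show "continuous_on C (\<lambda>z. a (krig_var k (map q [0..<m]) z, k z z))"
      by (rule continuous_on_compose2[OF a_cont])
        (use in_Delta in \<open>auto intro!: continuous_on_Pair continuous_on_krig_var k_cont design_lists_invertible kzz\<close>)
    show "continuous_on C (\<lambda>z. b (krig_var k [g 0] z, k z z))"
      by (rule continuous_on_compose2[OF b_cont])
        (use in_Delta(3) sub in \<open>auto intro!: continuous_on_Pair continuous_on_krig_var k_cont design_lists_invertible kzz\<close>)
    show "\<forall>z\<in>C. b (krig_var k [g 0] z, k z z) \<noteq> 0" using in_Delta(3) b_pos by fastforce
  qed
  then have "bounded ((\<lambda>z. a (krig_var k (map q [0..<m]) z, k z z) / b (krig_var k [g 0] z, k z z)) ` C)"
    using C(1) by (intro compact_imp_bounded compact_continuous_image)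
  then obtain B where "\<forall>y\<in>(\<lambda>z. a (krig_var k (map q [0..<m]) z, k z z) / b (krig_var k [g 0] z, k z z)) ` C. norm y \<le> B"
    unfolding bounded_iff by blast
  then show ?thesis by (intro exI[of _ B]) (auto intro: order_trans[OF abs_ge_self] simp del: abs_divide)
qed

text \<open>Comparison with a nearby point of the dense sequence. The level \<open>c / 8\<close> is
  the one required by \<open>mse_lower_bound\<close>.\<close>

lemma krig_var_eventually_small: "\<exists>N. \<forall>m\<ge>N. \<forall>z\<in>D. krig_var k (map q [0..<m]) z \<le> c / 8"
proof -
  obtain d where d: "d > 0" "\<And>z s. z \<in> D \<Longrightarrow> s \<in> D \<Longrightarrow> dist s z < d \<Longrightarrow> k z z - 2 * k z s + k s s < c / 8"
    using uniformly_small_increment[OF k_cont compact_D, of "c / 8"] c(1) by auto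
  obtain N where N: "\<forall>z\<in>D. \<exists>i<N. dist (q i) z < d" using q(3)[OF d(1)] by blast
  show ?thesis
  proof (intro exI allI impI ballI)
    fix m z assume m: "N \<le> m" and z: "z \<in> D"
    obtain i where i: "i < N" "dist (q i) z < d" using N z by blast
    have "krig_var k (map q [0..<m]) z \<le> k z z - 2 * k z (q i) + k (q i) (q i)"
      using i m z by (intro krig_var_le_point design_lists design_lists_invertible) auto
    also have "\<dots> < c / 8" using i z q by (intro d(2)) auto
    finally show "krig_var k (map q [0..<m]) z \<le> c / 8" by simp
  qed
qed

lemma design_in_D: "design_pts q g m s n i \<in> D"
  using q g by (auto simp: design_pts_def)

text \<open>The repeated observations at \<open>g 0\<close> lie in different blocks, so each block
  still has distinct rows.\<close>

lemma well_posed_design: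
  assumes "m + s < n"
  shows "well_posed k (design_pts q g m s n) (s + 2) (design_blocks m s n)"
  unfolding well_posed_def
proof
  fix l assume "l \<in> {1..s + 2}"
  then consider "l = 1" | "l = 2" | "3 \<le> l" by fastforce
  then show "invertible_mat (kmat k (submat (design_pts q g m s n) (design_blocks m s n l))
      (submat (design_pts q g m s n) (design_blocks m s n l)))"
    using design_lists_invertible by cases (simp_all only: submat_design[OF assms])
qed

lemma mse_design:
  assumes mn: "1 \<le> m" "1 \<le> s" "m + s < n"
    and B: "\<forall>z\<in>C. a (krig_var k (map q [0..<m]) z, k z z) / b (krig_var k [g 0] z, k z z) \<le> B" "2 * B \<le> real s"
    and small: "\<forall>z\<in>D. krig_var k (map q [0..<m]) z \<le> c / 8" and z: "z \<in> C"
  shows "c / 16 \<le> mse M k Y \<alpha> (design_pts q g m s n) (s + 2) (design_blocks m s n) z"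
proof -
  define X where "X = design_pts q g m s n"
  define I where "I = design_blocks m s n"
  define va where "va = var_args k X (s + 2) I z"
  define Q where "Q = map q [0..<m]"
  define T where "T = map g [0..<n - s - m]"
  note blocks = submat_design[OF mn(3), where q = q and g = g, folded X_def I_def Q_def T_def]
  have zD: "z \<in> D" using z C by auto
  have Qinv: "invertible_mat (kmat k Q Q)" "set Q \<subseteq> D" using design_lists design_lists_invertible unfolding Q_def by blast+
  have Tinv: "invertible_mat (kmat k T T)" "set T \<subseteq> D" using design_lists design_lists_invertible unfolding T_def by blast+
  have g0: "g 0 \<in> set T" using mn by (auto simp: T_def)
  define b0 where "b0 = b (krig_var k [g 0] z, k z z)"
  have b0: "b0 > 0" using in_Delta(3)[OF z] b_pos by (auto simp: b0_def)
  let ?v = "\<lambda>l. krig_var k (submat X (I l)) z"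
  have vD: "(?v l, k z z) \<in> Delta" if l: "l \<in> {1..s + 2}" for l
  proof -
    consider "l = 1" | "l = 2" | "3 \<le> l" using l by fastforce
    then show ?thesis
    proof cases
      case 3
      then show ?thesis using in_Delta(3)[OF z] blocks(3) by (auto simp: Delta_def Delta_int_def)
    qed (use in_Delta(1,2)[OF z] blocks in \<open>auto simp: Q_def T_def\<close>)
  qed
  \<comment> \<open>Each of the \<open>s\<close> one-point blocks contributes exactly
    \<open>b0\<close>; the first two blocks contribute non-negative terms.\<close>
  have "real s * b0 \<le> (\<Sum>l=1..s + 2. b (?v l, k z z))"
  proof -
    have "real s * b0 = (\<Sum>l=3..s + 2. b (?v l, k z z))"
      using blocks(3) by (simp add: b0_def)
    also have "\<dots> \<le> (\<Sum>l=1..s + 2. b (?v l, k z z))"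
      by (rule sum_mono2) (use vD b_nonneg in auto)
    finally show ?thesis .
  qed
  moreover have "real s * b0 > 0" using mn b0 by simp
  ultimately have sb: "0 < real s * b0" "real s * b0 \<le> (\<Sum>l=1..s + 2. b (?v l, k z z))" by auto
  have "\<alpha> (s + 2) 1 va \<le> a (?v 1, k z z) / (\<Sum>l=1..s + 2. b (?v l, k z z))"
  proof -
    have "1 \<le> n" using mn by simp
    moreover have "\<forall>i\<in>{1..n}. X i \<in> D" using design_in_D by (simp add: X_def)
    moreover have "row_partition n (s + 2) I" unfolding I_def by (rule row_partition_design[OF mn(1,3)])
    ultimately have "well_posed k X (s + 2) I \<and> (\<forall>l\<in>{1..s + 2}. (?v l, prior_var k z) \<in> Delta) \<and>
        (\<Sum>l=1..s + 2. b (?v l, prior_var k z)) \<noteq> 0 \<longrightarrow>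
        (\<forall>j\<in>{1..s + 2}. \<alpha> (s + 2) j va \<le> a (?v j, prior_var k z) / (\<Sum>l=1..s + 2. b (?v l, prior_var k z)))"
      using weights zD unfolding weights_bounded_def Let_def va_def by blast
    moreover have "well_posed k X (s + 2) I" unfolding X_def I_def by (rule well_posed_design[OF mn(3)])
    ultimately show ?thesis using vD sb by (auto simp: prior_var_def)
  qed
  also have "\<dots> \<le> a (?v 1, k z z) / (real s * b0)"
    using vD[of 1] a_nonneg
    by (intro divide_left_mono[OF sb(2)] mult_pos_pos[OF less_le_trans[OF sb] sb(1)]) auto
  also have "\<dots> = (a (krig_var k Q z, k z z) / b0) / real s" unfolding blocks(1) by (simp add: mult.commute)
  also have "\<dots> \<le> B / real s" using B(1) z by (intro divide_right_mono) (auto simp: Q_def b0_def)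
  also have "\<dots> \<le> 1 / 2" using B(2) mn by (simp add: field_simps)
  finally have w: "\<alpha> (s + 2) 1 va \<le> 1 / 2" .
  \<comment> \<open>All blocks but the first. Since \<open>g 0\<close> also belongs to the second
    block, their contribution lies in the span of the observations \<open>T\<close>, whatever the
    weights are.\<close>
  define W where "W = (\<lambda>\<omega>. \<Sum>j=2..s + 2. \<alpha> (s + 2) j va * krig_mean k Y (submat X (I j)) z \<omega>)"
  have W: "W \<in> lincombs Y (set T)" unfolding W_def
  proof (intro lincombs_sum_closed lincombs_scale)
    fix j assume "j \<in> {2..s + 2}"
    then consider "j = 2" | "3 \<le> j" by fastforce
    then show "krig_mean k Y (submat X (I j)) z \<in> lincombs Y (set T)"
    proof cases
      case 1
      then show ?thesis using krig_mean_lincomb[OF Tinv(1)] blocks(2) by simp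
    next
      case 2
      then show ?thesis
        using lincombs_mono[OF krig_mean_lincomb[OF design_lists_invertible(3)]] g0 blocks(3) by simp
    qed
  qed
  have agg: "aggregated k Y \<alpha> X (s + 2) I z \<omega> = \<alpha> (s + 2) 1 va * krig_mean k Y Q z \<omega> + W \<omega>" for \<omega>
  proof -
    have "(\<Sum>j=1..s + 2. f j) = f 1 + (\<Sum>j=2..s + 2. f j)" for f :: "nat \<Rightarrow> real"
      using sum.atLeast_Suc_atMost[of 1 "s + 2" f] by (simp add: numeral_2_eq_2)
    then show ?thesis unfolding aggregated_def va_def[symmetric] W_def by (simp only: blocks(1))
  qed
  have "c / 16 \<le> expectation (\<lambda>\<omega>. (Y z \<omega> - (\<alpha> (s + 2) 1 va * krig_mean k Y Q z \<omega> + W \<omega>))\<^sup>2)"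
  proof (rule mse_lower_bound[OF zD Tinv(2) krig_mean_lincombs_D[OF Qinv] W _ _ w])
    show "c \<le> expectation (\<lambda>\<omega>. (Y z \<omega> - Z \<omega>)\<^sup>2)" if "Z \<in> lincombs Y (set T)" for Z
      using c(2)[OF z, of "n - s - m"] krig_var_minimal[OF Tinv zD that] by (simp add: T_def)
    show "expectation (\<lambda>\<omega>. (Y z \<omega> - krig_mean k Y Q z \<omega>)\<^sup>2) \<le> c / 8"
      using small zD krig_residual_var[OF Qinv zD] by (simp add: Q_def)
  qed (use c in simp)
  then show ?thesis unfolding mse_def X_def[symmetric] I_def[symmetric] agg .
qed

theorem inconsistent_design:
  assumes C_pos: "emeasure lebesgue C > 0"
  shows "\<exists>(x :: nat \<Rightarrow> nat \<Rightarrow> real ^ 'd) (p :: nat \<Rightarrow> nat) (I :: nat \<Rightarrow> nat \<Rightarrow> nat set).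
           (\<forall>n\<ge>1. (\<forall>i\<in>{1..n}. x n i \<in> D) \<and> row_partition n (p n) (I n)
                    \<and> well_posed k (x n) (p n) (I n)) \<and>
           (\<lambda>n. SUP z\<in>D. Min ((\<lambda>i. norm (x n i - z)) ` {1..n})) \<longlonglongrightarrow> 0 \<and>
           filterlim p at_top sequentially \<and>
           (\<lambda>n. real (p n) / real n) \<longlonglongrightarrow> 0 \<and>
           liminf (\<lambda>n. \<integral>\<^sup>+z\<in>D. ennreal (mse M k Y \<alpha> (x n) (p n) (I n) z) \<partial>lebesgue) > 0 \<and>
           (\<exists>C. C \<subseteq> D \<and> C \<in> sets lebesgue \<and> emeasure lebesgue C > 0 \<and>
                (\<forall>x0\<in>C. \<not> (\<lambda>n. mse M k Y \<alpha> (x n) (p n) (I n) x0) \<longlonglongrightarrow> 0))"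
proof -
  obtain B where B: "\<And>m. \<forall>z\<in>C. a (krig_var k (map q [0..<m]) z, k z z) / b (krig_var k [g 0] z, k z z) \<le> B m"
    using ratio_bounded by metis
  \<comment> \<open>The square root tends to infinity, is negligible against \<open>n\<close>, and
    leaves room for the second block.\<close>
  define s where "s n = nat \<lfloor>sqrt (real n)\<rfloor>" for n
  have s_lim: "filterlim s at_top sequentially"
    unfolding s_def by real_asymp
  have s_ratio: "(\<lambda>n. real (s n + 2) / real n) \<longlonglongrightarrow> 0"
    unfolding s_def by real_asymp
  \<comment> \<open>The factor 2 turns the weight bound \<open>B (m n) / s n\<close> into
    1/2.\<close>
  obtain m where m: "filterlim m at_top sequentially" "\<And>n. m n \<le> s n"
      "\<And>n. 1 \<le> m n \<Longrightarrow> 2 * B (m n) \<le> real (s n)"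
    using slow_subsequence[OF s_lim, of "\<lambda>m. 2 * B m"] by blast
  \<comment> \<open>For the finitely many \<open>n\<close> too small for the design, \<open>n\<close> one-point blocks are used.\<close>
  define ok where "ok n \<longleftrightarrow> 1 \<le> m n \<and> m n + s n < n" for n
  define x where "x n = (if ok n then design_pts q g (m n) (s n) n else (\<lambda>_. g 0))" for n
  define p where "p n = (if ok n then s n + 2 else n)" for n
  define I where "I n = (if ok n then design_blocks (m n) (s n) n else (\<lambda>l. {l}))" for n
  have s3: "\<forall>\<^sub>F n in sequentially. 3 \<le> s n" using s_lim unfolding filterlim_at_top by blast
  have m1: "\<forall>\<^sub>F n in sequentially. N \<le> m n" for N using m(1) unfolding filterlim_at_top by blast
  have ok: "\<forall>\<^sub>F n in sequentially. ok n"
    using s3 m1[of 1]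
  proof eventually_elim
    case (elim n)
    \<comment> \<open>For \<open>s n\<close> at least 3, m + s is at most 2 s, which is below 3 s
      and hence below s^2 and \<open>n\<close>.\<close>
    have "real (s n) \<le> sqrt (real n)" unfolding s_def by simp
    then have "(real (s n))\<^sup>2 \<le> (sqrt (real n))\<^sup>2" by (intro power_mono) auto
    then have "real ((s n)\<^sup>2) \<le> real n" by simp
    then have "(s n)\<^sup>2 \<le> n" by (simp only: of_nat_le_iff)
    moreover have "3 * s n \<le> (s n)\<^sup>2" using elim by (simp add: power2_eq_square)
    ultimately show ?case using elim m(2)[of n] by (auto simp: ok_def)
  qed
  have xD: "x n i \<in> D" for n i using design_in_D g by (auto simp: x_def)
  have wf: "row_partition n (p n) (I n) \<and> well_posed k (x n) (p n) (I n)" for n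
  proof (cases "ok n")
    case True
    then show ?thesis
      using row_partition_design well_posed_design by (auto simp: ok_def x_def p_def I_def)
  next
    case False
    have "row_partition n n (\<lambda>l. {l})" by (auto simp: row_partition_def)
    moreover have "well_posed k (\<lambda>_. g 0) n (\<lambda>l. {l})"
      using design_lists_invertible(3) by (simp add: well_posed_def submat_def)
    ultimately show ?thesis using False by (simp add: x_def p_def I_def)
  qed
  have D_ne: "D \<noteq> {}" using q by auto
  have fill: "(\<lambda>n. SUP z\<in>D. Min ((\<lambda>i. norm (x n i - z)) ` {1..n})) \<longlonglongrightarrow> 0"
  proof (rule LIMSEQ_I)
    fix e :: real assume "e > 0"
    then obtain N where N: "\<forall>z\<in>D. \<exists>i<N. dist (q i) z < e / 2" using q(3)[of "e / 2"] by auto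
    have "\<forall>\<^sub>F n in sequentially. norm ((SUP z\<in>D. Min ((\<lambda>i. norm (x n i - z)) ` {1..n})) - 0) < e"
      using ok m1[of N]
    proof eventually_elim
      case (elim n)
      define h where "h z = Min ((\<lambda>i. norm (x n i - z)) ` {1..n})" for z
      have n: "1 \<le> n" using elim by (auto simp: ok_def)
      have h0: "0 \<le> h z" for z unfolding h_def using n by (subst Min_ge_iff) auto
      have he: "h z \<le> e / 2" if z: "z \<in> D" for z
      proof -
        obtain i where i: "i < N" "dist (q i) z < e / 2" using N z by blast
        \<comment> \<open>Rows count from 1 and the dense sequence from 0.\<close>
        have "x n (Suc i) = q i" "Suc i \<in> {1..n}"
          using i elim by (auto simp: x_def design_pts_def ok_def)
        then have "h z \<le> norm (q i - z)" unfolding h_def by (intro Min_le) (auto intro!: image_eqI[of _ _ "Suc i"])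
        then show ?thesis using i by (simp add: dist_norm)
      qed
      have bdd: "bdd_above (h ` D)" using he by (rule bdd_aboveI2)
      obtain z0 where "z0 \<in> D" using D_ne by auto
      then have "0 \<le> (SUP z\<in>D. h z)" using h0[of z0] bdd by (meson cSUP_upper2)
      moreover have "(SUP z\<in>D. h z) \<le> e / 2" using D_ne he by (rule cSUP_least)
      ultimately show ?case using \<open>e > 0\<close> unfolding h_def[symmetric] by simp
    qed
    then show "\<exists>no. \<forall>n\<ge>no. norm ((SUP z\<in>D. Min ((\<lambda>i. norm (x n i - z)) ` {1..n})) - 0) < e"
      by (simp add: eventually_sequentially)
  qed
  have p_eq: "\<forall>\<^sub>F n in sequentially. s n + 2 = p n" using ok by eventually_elim (simp add: p_def)
  have p_lim: "filterlim p at_top sequentially"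
  proof (rule filterlim_cong[THEN iffD1, OF refl refl p_eq])
    show "filterlim (\<lambda>n. s n + 2) at_top sequentially"
      by (rule filterlim_at_top_mono[OF s_lim]) simp
  qed
  have p_ratio: "(\<lambda>n. real (p n) / real n) \<longlonglongrightarrow> 0"
    by (rule Lim_transform_eventually[OF s_ratio]) (use p_eq in eventually_elim, simp)
  obtain N where N: "\<forall>m\<ge>N. \<forall>z\<in>D. krig_var k (map q [0..<m]) z \<le> c / 8"
    using krig_var_eventually_small by blast
  have mse: "\<forall>\<^sub>F n in sequentially. \<forall>z\<in>C. c / 16 \<le> mse M k Y \<alpha> (x n) (p n) (I n) z"
    using ok s3 m1[of N]
  proof eventually_elim
    case (elim n)
    show ?case
    proof
      fix z assume z: "z \<in> C"
      have mn: "1 \<le> m n" "1 \<le> s n" "m n + s n < n" using elim by (auto simp: ok_def)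
      have "\<forall>z\<in>D. krig_var k (map q [0..<m n]) z \<le> c / 8" using N elim(3) by blast
      from mse_design[OF mn B m(3)[OF mn(1)] this z]
      have "c / 16 \<le> mse M k Y \<alpha> (design_pts q g (m n) (s n) n) (s n + 2) (design_blocks (m n) (s n) n) z" .
      then show "c / 16 \<le> mse M k Y \<alpha> (x n) (p n) (I n) z" using elim(1) by (simp add: x_def p_def I_def)
    qed
  qed
  have Cm: "C \<in> sets lebesgue" using C(1) by (intro sets_completionI_sets) (simp add: compact_imp_closed borel_closed)
  \<comment> \<open>Only the part of the integral over \<open>C\<close> is kept, where the error is
    eventually at least \<open>c / 16\<close>.\<close>
  have "ennreal (c / 16) * emeasure lebesgue C \<le>
      liminf (\<lambda>n. \<integral>\<^sup>+z\<in>D. ennreal (mse M k Y \<alpha> (x n) (p n) (I n) z) \<partial>lebesgue)"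
  proof (rule Liminf_bounded)
    show "\<forall>\<^sub>F n in sequentially. ennreal (c / 16) * emeasure lebesgue C \<le>
        (\<integral>\<^sup>+z\<in>D. ennreal (mse M k Y \<alpha> (x n) (p n) (I n) z) \<partial>lebesgue)"
      using mse
    proof eventually_elim
      case (elim n)
      have "ennreal (c / 16) * emeasure lebesgue C = (\<integral>\<^sup>+z. ennreal (c / 16) * indicator C z \<partial>lebesgue)"
        by (rule nn_integral_cmult_indicator[OF Cm, symmetric])
      also have "\<dots> \<le> (\<integral>\<^sup>+z\<in>D. ennreal (mse M k Y \<alpha> (x n) (p n) (I n) z) \<partial>lebesgue)"
        using elim C(2) by (intro nn_integral_mono) (auto simp: indicator_def intro!: ennreal_leI)
      finally show ?case .
    qed
  qed
  moreover have "ennreal (c / 16) * emeasure lebesgue C > 0"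
    using c(1) C_pos by (simp add: ennreal_zero_less_mult_iff)
  ultimately have li: "liminf (\<lambda>n. \<integral>\<^sup>+z\<in>D. ennreal (mse M k Y \<alpha> (x n) (p n) (I n) z) \<partial>lebesgue) > 0"
    by (rule less_le_trans[rotated])
  have "\<not> (\<lambda>n. mse M k Y \<alpha> (x n) (p n) (I n) x0) \<longlonglongrightarrow> 0" if x0: "x0 \<in> C" for x0
  proof
    assume "(\<lambda>n. mse M k Y \<alpha> (x n) (p n) (I n) x0) \<longlonglongrightarrow> 0"
    then have "c / 16 \<le> 0"
      by (rule tendsto_lowerbound) (use mse x0 in \<open>auto elim: eventually_mono\<close>)
    then show False using c(1) by simp
  qed
  then show ?thesis using xD wf fill p_lim p_ratio li C(2) Cm C_pos by blast
qed

end

section \<open>Choice of the sequences and of the prediction set\<close>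

theorem proposition1:
  fixes D :: "(real ^ 'd) set"
    and M :: "'w measure"
    and Y :: "real ^ 'd \<Rightarrow> 'w \<Rightarrow> real"
    and k :: "real ^ 'd \<Rightarrow> real ^ 'd \<Rightarrow> real"
    and \<alpha> :: "nat \<Rightarrow> nat \<Rightarrow> real list \<Rightarrow> real"
    and a b :: "real \<times> real \<Rightarrow> real"
  assumes "compact D" and "interior D \<noteq> {}"
    and "gaussian_process M D Y"
    and "has_mean_zero M D Y"
    and "has_covariance M D Y k"
    and "continuous_on UNIV (\<lambda>(x, y). k x y)"
    and "\<exists>x\<in>interior D. \<exists>y\<in>interior D. x \<noteq> y \<and> k x y > 0"
    and "neb_property M D Y"
    and "continuous_on Delta a" and "continuous_on Delta b"
    and "\<forall>z\<in>Delta. 0 \<le> a z" and "\<forall>z\<in>Delta. 0 \<le> b z"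
    and "\<forall>z\<in>Delta_int. 0 < a z" and "\<forall>z\<in>Delta_int. 0 < b z"
    and "weights_bounded D k \<alpha> a b"
  shows "\<exists>(x :: nat \<Rightarrow> nat \<Rightarrow> real ^ 'd) (p :: nat \<Rightarrow> nat) (I :: nat \<Rightarrow> nat \<Rightarrow> nat set).
           (\<forall>n\<ge>1. (\<forall>i\<in>{1..n}. x n i \<in> D) \<and> row_partition n (p n) (I n)
                    \<and> well_posed k (x n) (p n) (I n)) \<and>
           (\<lambda>n. SUP z\<in>D. Min ((\<lambda>i. norm (x n i - z)) ` {1..n})) \<longlonglongrightarrow> 0 \<and>
           filterlim p at_top sequentially \<and>
           (\<lambda>n. real (p n) / real n) \<longlonglongrightarrow> 0 \<and>
           liminf (\<lambda>n. \<integral>\<^sup>+z\<in>D. ennreal (mse M k Y \<alpha> (x n) (p n) (I n) z) \<partial>lebesgue) > 0 \<and>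
           (\<exists>C. C \<subseteq> D \<and> C \<in> sets lebesgue \<and> emeasure lebesgue C > 0 \<and>
                (\<forall>x0\<in>C. \<not> (\<lambda>n. mse M k Y \<alpha> (x n) (p n) (I n) x0) \<longlonglongrightarrow> 0))"
proof -
  obtain xs ys where xy: "xs \<in> interior D" "ys \<in> interior D" "xs \<noteq> ys" "k xs ys > 0"
    using assms(7) by blast
  interpret neb_gaussian_process M D Y k
  proof
    show "gaussian_process M D Y" "has_mean_zero M D Y" "has_covariance M D Y k" "neb_property M D Y"
      by fact+
    show "\<exists>z\<in>D. z \<noteq> x" if "x \<in> D" for x using xy interior_subset by (metis subsetD)
  qed
  obtain r where r: "r > 0" "cball xs r \<subseteq> D" "cball ys r \<subseteq> D" "cball xs r \<inter> cball ys r = {}"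
      "\<forall>u\<in>cball xs r. \<forall>v\<in>cball ys r. k u v > 0"
    by (rule positive_cballs[OF assms(6) xy])
  have "infinite (cball ys r)" using r(1) uncountable_cball countable_finite by blast
  then obtain g :: "nat \<Rightarrow> real ^ 'd" where g: "inj g" "range g \<subseteq> cball ys r"
    using infinite_countable_subset by blast
  have "infinite D" using \<open>infinite (cball ys r)\<close> r(3) finite_subset by blast
  then obtain q :: "nat \<Rightarrow> real ^ 'd" where q: "inj q" "range q \<subseteq> D"
      "\<And>e. e > 0 \<Longrightarrow> \<exists>m. \<forall>z\<in>D. \<exists>i<m. dist (q i) z < e"
    using compact_dense_sequence[OF assms(1)] by blast
  have gD: "range g \<subseteq> D" using g(2) r(3) by blast
  \<comment> \<open>The closure of the observations from \<open>g\<close> misses the ball around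
    \<open>xs\<close>, so NEB gives a positive lower bound at every point of that ball.\<close>
  have cl: "closure (range g) \<subseteq> cball ys r" using g(2) by (intro closure_minimal) auto
  have inv: "invertible_mat (kmat k (map g [0..<n]) (map g [0..<n]))" for n
    by (rule invertible_kmat) (use g(1) gD in \<open>auto simp: distinct_map inj_on_def\<close>)
  \<comment> \<open>The lower bounds vary with the point. Sorting the points by the bounds 1 / (j +
    1) gives countably many closed sets that cover the ball, so one of them has positive measure and
    a uniform bound.\<close>
  define W where "W j = {z \<in> cball xs r. \<forall>n. 1 / real (Suc j) \<le> krig_var k (map g [0..<n]) z}" for j
  have W_closed: "closed (W j)" for j
  proof -
    have "W j = cball xs r \<inter> (\<Inter>n. {z. 1 / real (Suc j) \<le> krig_var k (map g [0..<n]) z})"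
      unfolding W_def by auto
    also have "closed \<dots>"
      by (intro closed_Int closed_cball closed_INT ballI closed_Collect_le continuous_on_const
          continuous_on_krig_var assms(6) inv)
    finally show ?thesis .
  qed
  have W_cover: "cball xs r \<subseteq> (\<Union>j. W j)"
  proof
    fix z assume z: "z \<in> cball xs r"
    then have "z \<in> D" "z \<notin> closure (range g)" using r cl by blast+
    then obtain e where e: "e > 0" "\<forall>n. krig_var k (map g [0..<n]) z \<ge> e"
      using krig_var_bounded_below[OF g(1) gD] by blast
    obtain j where "1 / real (Suc j) < e" using nat_approx_posE[OF e(1)] by blast
    then show "z \<in> (\<Union>j. W j)" using e(2) z by (auto simp: W_def intro: order_trans[OF less_imp_le])
  qed
  have null_q: "negligible (range q)"
    using countable_imp_null_set_lborel[of "range q"]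
    by (simp add: negligible_iff_null_sets null_sets_completionI)
  \<comment> \<open>Points of the dense sequence are removed because the variance of the first block
    must stay positive; only a null set is lost.\<close>
  define S where "S j = W j - range q" for j
  have meas: "W j \<in> sets lebesgue" "S j \<in> sets lebesgue" for j
  proof -
    show "W j \<in> sets lebesgue" using W_closed[of j] by (intro sets_completionI_sets) (simp add: borel_closed)
    moreover have "range q \<in> sets lebesgue" using null_q by (rule negligible_imp_sets)
    ultimately show "S j \<in> sets lebesgue" by (simp add: S_def)
  qed
  have "\<exists>j. emeasure lebesgue (S j) > 0"
  proof (rule ccontr)
    assume "\<not> ?thesis"
    then have "negligible (S j)" for j using negligible_iff_emeasure0[OF meas(2)] by (simp add: not_less)
    then have "negligible (\<Union>j. S j)" by (intro negligible_countable_Union) auto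
    then have "negligible ((\<Union>j. S j) \<union> range q)" using null_q by (rule negligible_Un)
    then have "negligible (ball xs r)"
      by (rule negligible_subset) (use W_cover ball_subset_cball in \<open>auto simp: S_def\<close>)
    then show False using open_not_negligible[of "ball xs r"] r(1) by simp
  qed
  then obtain j where "emeasure lebesgue (S j) > 0" by blast
  \<comment> \<open>Removing the dense sequence destroys closedness; an inner closed set restores
    it, and compactness follows as the ball is bounded.\<close>
  then obtain C where C: "closed C" "C \<subseteq> S j" "emeasure lebesgue C > 0"
    using lebesgue_inner_closed_pos[OF meas(2)] by blast
  note C_pos = C(3)
  have Cb: "C \<subseteq> cball xs r" using C(2) by (auto simp: S_def W_def)
  interpret kriging_counterexample M D Y k \<alpha> a b q g C "1 / real (Suc j)"
  proof
    show "compact C"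
      using C(1) Cb bounded_subset[OF bounded_cball] by (auto simp: compact_eq_bounded_closed)
    show "C \<subseteq> D" using Cb r(2) by blast
    show "C \<inter> range q = {}" using C(2) by (auto simp: S_def)
    show "C \<inter> range g = {}" using Cb g(2) r(4) by blast
    show "k z (g 0) > 0" if "z \<in> C" for z using that Cb g(2) r(5) by blast
    show "1 / real (Suc j) \<le> krig_var k (map g [0..<n]) z" if "z \<in> C" for z n
      using that C(2) by (auto simp: S_def W_def)
  qed (use assms q g gD in auto)
  show ?thesis by (rule inconsistent_design[OF C_pos])
qed

end
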